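(* Let $\alpha>1$ and $\sigma>0$ be real numbers, and let $s_1,s_2\in\mathbb R$ satisfy one of the following three conditions: (i) $s_1<\frac{2\sigma}{\alpha-1}$ (and $s_2\in\mathbb R$ arbitrary); (ii) $s_2<2\sigma$ (and $s_1\in\mathbb R$ arbitrary); (iii) $s_1=\frac{2\sigma}{\alpha-1}$ and $s_2\le\frac12-\frac{2\sigma}{\alpha-1}$. Then there exists a function $u_0\in L^2(\mathbb T)$ such that the sequence $$\Big(\big\vert\langle D_x\rangle^{\sigma}(e^{it\vert D_x\vert^{\alpha}}\Pi_Nu_0)\big\vert^2 - \Vert\Pi_Nu_0\Vert^2_{H^{\sigma}(\mathbb T)}\Big)_{N\ge0}$$ does not converge in the space $W^{-s_1,\infty}(\mathbb R, H^{-s_2}(\mathbb T))$.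
   Context: $\mathbb T=\mathbb R/2\pi\mathbb Z$, equipped with Lebesgue measure normalized to total mass $1$. For $f\in\mathscr S'(\mathbb T)=(C^\infty(\mathbb T))'$, $\widehat f(n)$, $n\in\mathbb Z$, denotes the $n$-th Fourier coefficient, so that $\widehat f(n)=\int_{\mathbb T}f(x)e^{-inx}\,\mathrm dx$ for $f\in L^1(\mathbb T)$, and $\Vert f\Vert_{L^2(\mathbb T)}^2=\sum_n|\widehat f(n)|^2$. For $\sigma\in\mathbb R$, $\langle D_x\rangle^\sigma$ is the Fourier multiplier $\widehat{\langle D_x\rangle^{\sigma}f}(n)=\langle n\rangle^\sigma\widehat f(n)$ with $\langle y\rangle=(1+y^2)^{1/2}$ for $y\in\mathbb R$, and $\Vert f\Vert_{H^\sigma(\mathbb T)}=\Vert\langle D_x\rangle^\sigma f\Vert_{L^2(\mathbb T)}$. For $t\in\mathbb R$, $$(e^{it\vert D_x\vert^{\alpha}}u_0)(x)=\sum_{n\in\mathbb Z}\widehat{u_0}(n)e^{it|n|^\alpha}e^{inx},$$ and for $N\ge0$, $(\Pi_Nu_0)(x)=\sum_{|n|\le N}\widehat{u_0}(n)e^{inx}$. $\mathscr S'(\mathbb R\times\mathbb T)$ is the dual of the space $\mathscr S(\mathbb R\times\mathbb T)$ of smooth functions on $\mathbb R\times\mathbb T$ that are rapidly decreasing in $t$ together with all their derivatives. For $s\in\mathbb R$, $\langle D_t\rangle^s$ is the Fourier multiplier by $\langle\tau\rangle^s$ in the time variable ($\tau\in\mathbb R$ being the frequency dual to $t$). For $s_1,s_2\in\mathbb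 R$, $$W^{-s_1,\infty}(\mathbb R, H^{-s_2}(\mathbb T)) = \big\{\varphi\in\mathscr S'(\mathbb R\times\mathbb T) : \langle D_t\rangle^{-s_1}\varphi\in L^{\infty}(\mathbb R,H^{-s_2}(\mathbb T))\big\},$$ with norm $\sup_{t\in\mathbb R}\Vert\langle D_t\rangle^{-s_1}\varphi(t,\cdot)\Vert_{H^{-s_2}(\mathbb T)}$ (essential supremum). *)

theory Defs
  imports "HOL-Probability.Probability"
begin

section \<open>Functions and distributions on the circle\<close>

text \<open>Functions on the circle are \<open>2\<pi>\<close>-periodic functions on the real line; the circle has
  total mass 1.\<close>

definition torus_integral :: "(real \<Rightarrow> complex) \<Rightarrow> complex" where
  "torus_integral f = (1 / (2 * pi)) *\<^sub>R (LBINT x:{0..2 * pi}. f x)"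

definition L2_torus :: "(real \<Rightarrow> complex) set" where
  "L2_torus = {u \<in> borel_measurable borel.
     (\<forall>x. u (x + 2 * pi) = u x) \<and>
     set_integrable lborel {0..2 * pi} (\<lambda>x. (norm (u x))\<^sup>2)}"

definition fourier_coeff :: "(real \<Rightarrow> complex) \<Rightarrow> int \<Rightarrow> complex" where
  "fourier_coeff f n = torus_integral (\<lambda>x. f x * cis (- (of_int n * x)))"

definition japanese :: "real \<Rightarrow> real" where
  "japanese y = sqrt (1 + y\<^sup>2)"

text \<open>The iterated derivative is the \<open>k\<close>-fold iterate of this operator; where the derivative does
  not exist the value is irrelevant, since differentiability is required separately below.\<close>

definition D1 :: "(real \<Rightarrow> complex) \<Rightarrow> real \<Rightarrow> complex" where
  "D1 f = (\<lambda>x. vector_derivative f (at x))"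

definition test_torus :: "(real \<Rightarrow> complex) set" where
  "test_torus = {\<theta>. (\<forall>x. \<theta> (x + 2 * pi) = \<theta> x) \<and> (\<forall>k x. (D1 ^^ k) \<theta> differentiable (at x))}"

text \<open>A distribution is a functional on all functions of which only the values on test functions
  matter. Continuity is the usual estimate by finitely many of the defining seminorms.\<close>

definition distribution_torus :: "((real \<Rightarrow> complex) \<Rightarrow> complex) \<Rightarrow> bool" where
  "distribution_torus \<Lambda> \<longleftrightarrow>
     (\<forall>\<theta>\<in>test_torus. \<forall>\<eta>\<in>test_torus. \<Lambda> (\<lambda>x. \<theta> x + \<eta> x) = \<Lambda> \<theta> + \<Lambda> \<eta>) \<and>
     (\<forall>c. \<forall>\<theta>\<in>test_torus. \<Lambda> (\<lambda>x. c * \<theta> x) = c * \<Lambda> \<theta>) \<and>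
     (\<exists>C M. \<forall>\<theta>\<in>test_torus. norm (\<Lambda> \<theta>) \<le> C * (\<Sum>k\<le>M. SUP x. norm ((D1 ^^ k) \<theta> x)))"

definition dist_coeff :: "((real \<Rightarrow> complex) \<Rightarrow> complex) \<Rightarrow> int \<Rightarrow> complex" where
  "dist_coeff \<Lambda> n = \<Lambda> (\<lambda>x. cis (- (of_int n * x)))"

text \<open>The Sobolev norm in terms of the sequence of Fourier coefficients, which is shared by
  functions (\<open>fourier_coeff\<close>) and distributions (\<open>dist_coeff\<close>). It is meaningful
  only when the series is summable.\<close>

definition sobolev_norm :: "real \<Rightarrow> (int \<Rightarrow> complex) \<Rightarrow> real" where
  "sobolev_norm r c = sqrt (\<Sum>\<^sub>\<infinity>n. (norm (of_real (japanese (of_int n) powr r) * c n))\<^sup>2)"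

definition sobolev_torus :: "real \<Rightarrow> ((real \<Rightarrow> complex) \<Rightarrow> complex) set" where
  "sobolev_torus r = {\<Lambda>. distribution_torus \<Lambda> \<and>
     (\<lambda>n. (norm (of_real (japanese (of_int n) powr r) * dist_coeff \<Lambda> n))\<^sup>2) summable_on UNIV}"

section \<open>Tempered distributions on the line times the circle\<close>

text \<open>Functions take the time variable first.\<close>

definition partial_t :: "(real \<Rightarrow> real \<Rightarrow> complex) \<Rightarrow> real \<Rightarrow> real \<Rightarrow> complex" where
  "partial_t \<psi> = (\<lambda>t x. D1 (\<lambda>r. \<psi> r x) t)"

definition partial_x :: "(real \<Rightarrow> real \<Rightarrow> complex) \<Rightarrow> real \<Rightarrow> real \<Rightarrow> complex" where
  "partial_x \<psi> = (\<lambda>t x. D1 (\<psi> t) x)"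

definition partial :: "nat \<Rightarrow> nat \<Rightarrow> (real \<Rightarrow> real \<Rightarrow> complex) \<Rightarrow> real \<Rightarrow> real \<Rightarrow> complex" where
  "partial j k \<psi> = (partial_t ^^ j) ((partial_x ^^ k) \<psi>)"

text \<open>By Schwarz's theorem on mixed derivatives, existence and joint continuity of the partial
  derivatives taken in this one order already give joint smoothness.\<close>

definition smooth2 :: "(real \<Rightarrow> real \<Rightarrow> complex) \<Rightarrow> bool" where
  "smooth2 \<psi> \<longleftrightarrow> (\<forall>j k.
     continuous_on UNIV (\<lambda>(t, x). partial j k \<psi> t x) \<and>
     (\<forall>t x. (\<lambda>r. partial j k \<psi> r x) differentiable (at t) \<and> partial j k \<psi> t differentiable (at x)))"

definition schwartz :: "(real \<Rightarrow> real \<Rightarrow> complex) set" where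
  "schwartz = {\<psi>. smooth2 \<psi> \<and> (\<forall>t x. \<psi> t (x + 2 * pi) = \<psi> t x) \<and>
     (\<forall>m j k. bdd_above (range (\<lambda>(t, x). (1 + \<bar>t\<bar>) ^ m * norm (partial j k \<psi> t x))))}"

definition schwartz_seminorm :: "nat \<Rightarrow> nat \<Rightarrow> nat \<Rightarrow> (real \<Rightarrow> real \<Rightarrow> complex) \<Rightarrow> real" where
  "schwartz_seminorm m j k \<psi> = (SUP (t, x). (1 + \<bar>t\<bar>) ^ m * norm (partial j k \<psi> t x))"

type_synonym functional = "(real \<Rightarrow> real \<Rightarrow> complex) \<Rightarrow> complex"

definition tempered_distribution :: "functional \<Rightarrow> bool" where
  "tempered_distribution T \<longleftrightarrow>
     (\<forall>\<psi>\<in>schwartz. \<forall>\<eta>\<in>schwartz. T (\<lambda>t x. \<psi> t x + \<eta> t x) = T \<psi> + T \<eta>) \<and>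
     (\<forall>c. \<forall>\<psi>\<in>schwartz. T (\<lambda>t x. c * \<psi> t x) = c * T \<psi>) \<and>
     (\<exists>C M. \<forall>\<psi>\<in>schwartz.
        norm (T \<psi>) \<le> C * (\<Sum>j\<le>M. \<Sum>k\<le>M. schwartz_seminorm M j k \<psi>))"

definition dist_of_fun :: "(real \<Rightarrow> real \<Rightarrow> complex) \<Rightarrow> functional" where
  "dist_of_fun F = (\<lambda>\<psi>. LBINT t. torus_integral (\<lambda>x. F t x * \<psi> t x))"

definition Dt_test :: "real \<Rightarrow> (real \<Rightarrow> real \<Rightarrow> complex) \<Rightarrow> real \<Rightarrow> real \<Rightarrow> complex" where
  "Dt_test s \<psi> = (\<lambda>t x. (1 / (2 * pi)) *\<^sub>R
     (LBINT \<tau>. of_real (japanese \<tau> powr s) * (LBINT r. \<psi> r x * cis (- (r * \<tau>))) * cis (t * \<tau>)))"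

text \<open>Extension to distributions by duality; the multiplier is its own transpose because its
  symbol is even.\<close>

definition Dt_pow :: "real \<Rightarrow> functional \<Rightarrow> functional" where
  "Dt_pow s T = (\<lambda>\<psi>. T (Dt_test s \<psi>))"

section \<open>The spaces of bounded functions of time with values in a Sobolev space\<close>

text \<open>Measurability is weak measurability, which is equivalent to strong measurability since the
  Sobolev spaces are separable Hilbert spaces with test functions dense in the dual.\<close>

definition Linf_Sobolev :: "real \<Rightarrow> (real \<Rightarrow> (real \<Rightarrow> complex) \<Rightarrow> complex) set" where
  "Linf_Sobolev r = {g.
     (\<forall>t. g t \<in> sobolev_torus r) \<and>
     (\<forall>\<theta>\<in>test_torus. (\<lambda>t. g t \<theta>) \<in> borel_measurable borel) \<and>
     esssup lborel (\<lambda>t. ereal (sobolev_norm r (dist_coeff (g t)))) < \<infinity>}"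

definition represents :: "(real \<Rightarrow> (real \<Rightarrow> complex) \<Rightarrow> complex) \<Rightarrow> functional \<Rightarrow> bool" where
  "represents g T \<longleftrightarrow> (\<forall>\<psi>\<in>schwartz. T \<psi> = (LBINT t. g t (\<psi> t)))"

text \<open>With \<open>a = - s\<^sub>1\<close> and \<open>b = - s\<^sub>2\<close> these are the space \<open>W\<close> with exponents
  \<open>- s\<^sub>1, \<infinity>\<close> over \<open>H\<close> with exponent \<open>- s\<^sub>2\<close>, and its norm. The
  representing function of a distribution is unique up to a null set, so that the infimum merely
  selects its essential supremum; it is \<open>\<infinity>\<close> if there is no representing function.\<close>

definition W_space :: "real \<Rightarrow> real \<Rightarrow> functional set" where
  "W_space a b = {\<phi>. tempered_distribution \<phi> \<and> (\<exists>g\<in>Linf_Sobolev b. represents g (Dt_pow a \<phi>))}"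

definition W_norm :: "real \<Rightarrow> real \<Rightarrow> functional \<Rightarrow> ereal" where
  "W_norm a b \<phi> = (INF g\<in>{g \<in> Linf_Sobolev b. represents g (Dt_pow a \<phi>)}.
     esssup lborel (\<lambda>t. ereal (sobolev_norm b (dist_coeff (g t)))))"

definition W_convergent :: "real \<Rightarrow> real \<Rightarrow> (nat \<Rightarrow> functional) \<Rightarrow> bool" where
  "W_convergent a b T \<longleftrightarrow>
     (\<exists>\<phi>\<in>W_space a b. (\<lambda>N. W_norm a b (\<lambda>\<psi>. T N \<psi> - \<phi> \<psi>)) \<longlonglongrightarrow> 0)"

section \<open>The renormalized squares\<close>

text \<open>Only applied to trigonometric polynomials, for which the sum is finite.\<close>

definition x_multiplier :: "(int \<Rightarrow> complex) \<Rightarrow> (real \<Rightarrow> complex) \<Rightarrow> real \<Rightarrow> complex" where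
  "x_multiplier m f = (\<lambda>x. \<Sum>\<^sub>\<infinity>n. m n * fourier_coeff f n * cis (of_int n * x))"

definition Dx_pow :: "real \<Rightarrow> (real \<Rightarrow> complex) \<Rightarrow> real \<Rightarrow> complex" where
  "Dx_pow r = x_multiplier (\<lambda>n. of_real (japanese (of_int n) powr r))"

definition propagator :: "real \<Rightarrow> real \<Rightarrow> (real \<Rightarrow> complex) \<Rightarrow> real \<Rightarrow> complex" where
  "propagator \<alpha> t = x_multiplier (\<lambda>n. cis (t * \<bar>of_int n\<bar> powr \<alpha>))"

definition Pi_proj :: "nat \<Rightarrow> (real \<Rightarrow> complex) \<Rightarrow> real \<Rightarrow> complex" where
  "Pi_proj N f = (\<lambda>x. \<Sum>n\<in>{- int N..int N}. fourier_coeff f n * cis (of_int n * x))"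

definition renormalized_square ::
  "real \<Rightarrow> real \<Rightarrow> (real \<Rightarrow> complex) \<Rightarrow> nat \<Rightarrow> real \<Rightarrow> real \<Rightarrow> complex" where
  "renormalized_square \<alpha> \<sigma> u N = (\<lambda>t x. of_real
     ((norm (Dx_pow \<sigma> (propagator \<alpha> t (Pi_proj N u)) x))\<^sup>2
      - (sobolev_norm \<sigma> (fourier_coeff (Pi_proj N u)))\<^sup>2))"

end

theory Submission
  imports Defs "HOL-Real_Asymp.Real_Asymp"
begin

text \<open>For Fourier coefficients \<open>c\<^sub>n \<ge> 0\<close>, the \<open>k\<close>-th coefficient of the renormalized square at time \<open>t\<close> is
  (for \<open>k \<noteq> 0\<close>) the sum of \<open>d\<^sub>n d\<^sub>m e\<^bsup>i t \<omega>\<^esup>\<close> over \<open>n - m = k\<close>, where \<open>d\<^sub>n\<close> is the weighted coefficient of \<open>u\<close>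
  and \<open>\<omega>\<close> is the difference of the two dispersion frequencies. Applying the multiplier in time inserts
  the weight \<open>\<langle>\<omega>\<rangle>\<close> to the power \<open>- s\<^sub>1\<close>. All summands are nonnegative at \<open>t = 0\<close>, so nothing cancels
  there, and the norm in \<open>W\<close> controls the Sobolev norm at \<open>t = 0\<close>. By duality it controls the number
  \<open>pairing\<close>, in which the coefficients at time zero are summed against finitely many weights \<open>b\<^sub>k \<ge> 0\<close>.

  Convergence makes the pairings bounded as the truncation grows (\<open>W_convergent_pairing_bounded\<close>). To see
  this, the distributions are tested against \<open>\<psi>(t,x) = \<gamma>(t) \<Sum>b\<^sub>k e\<^bsup>- i k x\<^esup>\<close> with a Gaussian density \<open>\<gamma>\<close> of
  standard deviation \<open>\<delta>\<close>. Fourier inversion evaluates the result exactly (\<open>renormalized_square_pairing\<close>): every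
  summand is damped by the factor \<open>exp (- \<delta>\<^sup>2 \<omega>\<^sup>2 / 2)\<close>, which tends to 1 as \<open>\<delta>\<close> tends to zero.

  It remains to contradict this bound. A finite block \<open>w\<close> of nonnegative coefficients of norm at most 1 can have an arbitrarily
  large pairing with normalized weights \<open>b\<close>, in each of the three cases for a different reason:
  \<^item> two neighbouring frequencies \<open>n, n + 1\<close> give a term of size \<open>n\<close> to the power
    \<open>2\<sigma> - (\<alpha> - 1)s\<^sub>1\<close> in the mode \<open>k = 1\<close>;
  \<^item> two opposite frequencies \<open>n, - n\<close> are exactly resonant, \<open>\<omega> = 0\<close>, and give a term whose
    weighted size is \<open>n\<close> to the power \<open>2\<sigma> - s\<^sub>2\<close> in the mode \<open>k = 2n\<close>;
  \<^item> at the critical exponents a full interval of frequencies of length comparable to \<open>L\<close> gives, in each mode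
    \<open>k \<le> L\<close>, a coefficient of size \<open>k\<close> to the power \<open>- s\<^sub>1\<close>, and the weighted square sum
    of these is at least comparable to the harmonic sum up to \<open>L\<close>.

  Finally, \<open>u\<close> is the sum of \<open>2\<^bsup>- j\<^esup>\<close> times blocks whose pairings are at least \<open>4\<^sup>j j\<close>. The pairing is
  quadratic and monotone in nonnegative coefficients, so the pairing of \<open>u\<close> is at least \<open>j\<close> for every \<open>j\<close>;
  for the same reason the blocks may overlap.\<close>

section \<open>Trigonometric polynomials on the circle\<close>

lemma japanese_ge: "1 \<le> japanese y" "\<bar>y\<bar> \<le> japanese y"
  by (auto simp: japanese_def intro: real_le_rsqrt)

lemma japanese_pos: "0 < japanese y"
  by (rule less_le_trans[OF zero_less_one japanese_ge(1)])

lemma japanese_le: "japanese y \<le> 1 + \<bar>y\<bar>"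
  unfolding japanese_def by (rule real_le_lsqrt) (auto simp: power2_sum)

lemma japanese_powr: "japanese y powr s = (1 + y\<^sup>2) powr (s / 2)"
  by (simp add: japanese_def powr_half_sqrt[symmetric] powr_powr add_nonneg_nonneg)

lemma abs_le_one_plus_square: "\<bar>t\<bar> \<le> 1 + t\<^sup>2" for t :: real
proof -
  have "0 \<le> (\<bar>t\<bar> - 1)\<^sup>2" "0 \<le> t\<^sup>2" by auto
  then show ?thesis unfolding power2_diff power2_abs one_power2 mult_1_right by linarith
qed

lemma cis_has_vector_derivative [derivative_intros]:
  fixes f :: "real \<Rightarrow> real"
  assumes "(f has_real_derivative f') (at x within A)"
  shows "((\<lambda>x. cis (f x)) has_vector_derivative (of_real f' * \<i> * cis (f x))) (at x within A)"
  unfolding cis_conv_exp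
  apply (rule has_vector_derivative_eq_rhs)
  apply (rule field_vector_diff_chain_within[unfolded o_def, where g'="exp (\<i> * of_real (f x))"
     and f="\<lambda>x. \<i> * of_real (f x)"])
  using assms
  by (auto intro!: derivative_eq_intros simp: has_real_derivative_iff_has_vector_derivative has_vector_derivative_of_real)

lemma torus_integral_cis: "torus_integral (\<lambda>x. cis (of_int k * x)) = (if k = 0 then 1 else 0)"
proof (cases "k = 0")
  case True
  then show ?thesis
    by (simp add: torus_integral_def set_lebesgue_integral_def)
next
  case False
  define F where "F = (\<lambda>x. cis (of_int k * x) / (\<i> * of_int k))"
  have "(LBINT x. indicator {0..2*pi} x *\<^sub>R cis (of_int k * x)) = F (2 * pi) - F 0"
  proof (rule integral_FTC_Icc)
    show "(F has_vector_derivative cis (of_int k * x)) (at x within {0..2 * pi})" for x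
      unfolding F_def using False
      by (auto intro!: derivative_eq_intros has_vector_derivative_divide)
  qed (auto intro!: continuous_intros)
  moreover have "cis (of_int k * (2 * pi)) = 1"
    using cis_multiple_2pi[of "of_int k"] by (simp add: mult.commute mult.left_commute)
  then have "F (2 * pi) = F 0" by (simp add: F_def)
  ultimately show ?thesis using False
    by (simp add: torus_integral_def set_lebesgue_integral_def)
qed

lemma set_integrable_continuous_torus:
  fixes f :: "real \<Rightarrow> 'a::euclidean_space"
  shows "continuous_on UNIV f \<Longrightarrow> set_integrable lborel {0..2*pi} f"
  by (intro borel_integrable_compact[OF compact_Icc, folded set_integrable_def] )
   (auto intro: continuous_on_subset)

text \<open>The frequencies \<open>k i\<close> may repeat. Thus products of trigonometric polynomials, indexed by pairs or
  triples, can be integrated without first collecting equal frequencies.\<close>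

lemma torus_integral_trig:
  assumes "finite S"
  shows "torus_integral (\<lambda>x. \<Sum>i\<in>S. a i * cis (of_int (k i) * x)) = (\<Sum>i\<in>S. if k i = 0 then a i else 0)"
proof -
  have int: "set_integrable lborel {0..2*pi} (\<lambda>x. a i * cis (of_int (k i) * x))" for i
    by (intro set_integrable_continuous_torus continuous_intros)
  have "torus_integral (\<lambda>x. \<Sum>i\<in>S. a i * cis (of_int (k i) * x))
      = (\<Sum>i\<in>S. a i * torus_integral (\<lambda>x. cis (of_int (k i) * x)))"
  proof -
    have "(LBINT x:{0..2*pi}. \<Sum>i\<in>S. a i * cis (of_int (k i) * x))
        = (\<Sum>i\<in>S. LBINT x:{0..2*pi}. a i * cis (of_int (k i) * x))"
      using int unfolding set_lebesgue_integral_def set_integrable_def scaleR_sum_right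
      by (intro Bochner_Integration.integral_sum)
    then show ?thesis by (simp add: torus_integral_def scaleR_sum_right)
  qed
  also have "\<dots> = (\<Sum>i\<in>S. if k i = 0 then a i else 0)"
    by (intro sum.cong) (auto simp: torus_integral_cis)
  finally show ?thesis .
qed

lemma fourier_coeff_trig:
  assumes "finite S"
  shows "fourier_coeff (\<lambda>x. \<Sum>i\<in>S. a i * cis (of_int (k i) * x)) n = (\<Sum>i\<in>S. if k i = n then a i else 0)"
proof -
  have "fourier_coeff (\<lambda>x. \<Sum>i\<in>S. a i * cis (of_int (k i) * x)) n
      = torus_integral (\<lambda>x. \<Sum>i\<in>S. a i * cis (of_int (k i - n) * x))"
    unfolding fourier_coeff_def
    by (simp add: sum_distrib_right cis_mult mult.assoc left_diff_distrib)
  then show ?thesis using torus_integral_trig[OF assms, of a "\<lambda>i. k i - n"] by simp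
qed

lemma fourier_coeff_trig_id:
  assumes "finite S"
  shows "fourier_coeff (\<lambda>x. \<Sum>i\<in>S. a i * cis (of_int i * x)) n = (if n \<in> S then a n else 0)"
  using fourier_coeff_trig[OF assms, of a id n] assms by (simp add: sum.delta)

lemma x_multiplier_trig:
  assumes "finite S"
  shows "x_multiplier m (\<lambda>x. \<Sum>i\<in>S. a i * cis (of_int i * x)) = (\<lambda>x. \<Sum>i\<in>S. (m i * a i) * cis (of_int i * x))"
proof
  fix x
  have "x_multiplier m (\<lambda>x. \<Sum>i\<in>S. a i * cis (of_int i * x)) x
     = (\<Sum>\<^sub>\<infinity>n. m n * (if n \<in> S then a n else 0) * cis (of_int n * x))"
    unfolding x_multiplier_def fourier_coeff_trig_id[OF assms] ..
  also have "\<dots> = (\<Sum>\<^sub>\<infinity>n\<in>S. (m n * a n) * cis (of_int n * x))"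
    by (rule infsum_cong_neutral) auto
  also have "\<dots> = (\<Sum>n\<in>S. (m n * a n) * cis (of_int n * x))"
    using assms by simp
  finally show "x_multiplier m (\<lambda>x. \<Sum>i\<in>S. a i * cis (of_int i * x)) x = (\<Sum>i\<in>S. (m i * a i) * cis (of_int i * x))" .
qed

lemma cis_periodic: "cis (- (of_int k * (x + 2 * pi))) = cis (- (of_int k * x))"
proof -
  have "cis (- (of_int k * (x + 2 * pi))) = cis (- (of_int k * x)) * cis (2 * pi * of_int (- k))"
    unfolding cis_mult by (simp add: algebra_simps)
  then show ?thesis using cis_multiple_2pi[of "of_int (- k)"] by simp
qed

section \<open>Square integrable functions from blocks of Fourier coefficients\<close>

text \<open>The weights \<open>(1/2)\<^sup>j\<close> have total mass 2, so this is the Cauchy--Schwarz inequality for the measure with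
  these weights. It replaces completeness of \<open>L\<^sup>2\<close> in the construction of \<open>u\<close>: integrability of the
  series of squares gives both convergence almost everywhere and square integrability of the sum.\<close>

lemma jensen_geometric:
  fixes y :: "nat \<Rightarrow> real"
  assumes "\<And>j. y j \<ge> 0" and s2: "summable (\<lambda>j. (1/2)^j * (y j)\<^sup>2)"
  shows "summable (\<lambda>j. (1/2)^j * y j)" and "(\<Sum>j. (1/2)^j * y j)\<^sup>2 \<le> 2 * (\<Sum>j. (1/2)^j * (y j)\<^sup>2)"
proof -
  have g: "summable (\<lambda>j. (1/2::real)^j)" by (simp add: summable_geometric)
  have "summable (\<lambda>j. (1/2)^j + (1/2)^j * (y j)\<^sup>2)"
    using g s2 by (rule summable_add)
  then show s1: "summable (\<lambda>j. (1/2)^j * y j)"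
  proof (rule summable_comparison_test'[where N=0])
    fix n :: nat
    have "y n \<le> 1 + (y n)\<^sup>2"
      using sum_squares_ge_zero[of "y n - 1" "y n"] by (simp add: power2_eq_square algebra_simps)
    then have "(1/2)^n * y n \<le> (1/2)^n * (1 + (y n)\<^sup>2)"
      by (intro mult_left_mono) auto
    then show "norm ((1/2)^n * y n) \<le> (1/2)^n + (1/2)^n * (y n)\<^sup>2"
      using assms(1)[of n] by (simp add: algebra_simps)
  qed
  have "(\<Sum>j<J. (1/2)^j * y j)\<^sup>2 \<le> 2 * (\<Sum>j. (1/2)^j * (y j)\<^sup>2)" for J
  proof -
    have "(\<Sum>j<J. (1/2)^j * y j)\<^sup>2 = (\<Sum>j<J. sqrt ((1/2)^j) * (sqrt ((1/2)^j) * y j))\<^sup>2"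
      by (intro arg_cong[where f="\<lambda>x. x\<^sup>2"] sum.cong) (auto simp flip: mult.assoc)
    also have "\<dots> \<le> (\<Sum>j<J. (sqrt ((1/2)^j))\<^sup>2) * (\<Sum>j<J. (sqrt ((1/2)^j) * y j)\<^sup>2)"
      by (rule Cauchy_Schwarz_ineq_sum)
    also have "\<dots> = (\<Sum>j<J. (1/2)^j) * (\<Sum>j<J. (1/2)^j * (y j)\<^sup>2)"
      by (simp add: power_mult_distrib)
    also have "\<dots> \<le> (\<Sum>j. (1/2)^j) * (\<Sum>j. (1/2)^j * (y j)\<^sup>2)"
      by (intro mult_mono sum_le_suminf g s2 sum_nonneg suminf_nonneg) auto
    also have "(\<Sum>j. (1/2::real)^j) = 2" by (simp add: suminf_geometric)
    finally show ?thesis .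
  qed
  moreover have "(\<lambda>J. (\<Sum>j<J. (1/2)^j * y j)\<^sup>2) \<longlonglongrightarrow> (\<Sum>j. (1/2)^j * y j)\<^sup>2"
    using summable_LIMSEQ[OF s1] by (intro tendsto_power)
  ultimately show "(\<Sum>j. (1/2)^j * y j)\<^sup>2 \<le> 2 * (\<Sum>j. (1/2)^j * (y j)\<^sup>2)"
    by (blast intro: LIMSEQ_le_const2)
qed

lemma AE_summable_of_summable_integrals:
  fixes f :: "nat \<Rightarrow> 'a \<Rightarrow> real"
  assumes int: "\<And>j. integrable M (f j)" and nn: "\<And>j x. f j x \<ge> 0" and "summable (\<lambda>j. \<integral>x. f j x \<partial>M)"
  shows "AE x in M. summable (\<lambda>j. f j x)"
proof -
  have [measurable]: "f j \<in> borel_measurable M" for j using int by auto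
  have "(\<integral>\<^sup>+x. (\<Sum>j. ennreal (f j x)) \<partial>M) = (\<Sum>j. \<integral>\<^sup>+x. ennreal (f j x) \<partial>M)"
    by (rule nn_integral_suminf) auto
  also have "\<dots> = (\<Sum>j. ennreal (\<integral>x. f j x \<partial>M))"
    by (intro suminf_cong nn_integral_eq_integral int) (auto simp: nn)
  also have "\<dots> \<noteq> \<infinity>"
    using assms by (subst suminf_ennreal2) (auto intro!: integral_nonneg_AE)
  finally have "AE x in M. (\<Sum>j. ennreal (f j x)) \<noteq> \<infinity>"
    by (intro nn_integral_PInf_AE) auto
  then show ?thesis
    by eventually_elim (auto intro!: summable_suminf_not_top nn)
qed

text \<open>The integrals of \<open>(1/2)\<^sup>j |v j|\<^sup>2\<close> are summable, so \<open>jensen_geometric\<close> applies at almost every point. With \<open>e\<close> a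
  character the second part computes the Fourier coefficients of the sum.\<close>

lemma L2_geometric_series:
  fixes v :: "nat \<Rightarrow> 'a \<Rightarrow> complex"
  assumes "finite_measure M" and [measurable]: "\<And>j. v j \<in> borel_measurable M"
    and sq: "\<And>j. integrable M (\<lambda>x. (norm (v j x))\<^sup>2)" and le: "\<And>j. (\<integral>x. (norm (v j x))\<^sup>2 \<partial>M) \<le> C"
  defines "u \<equiv> \<lambda>x. \<Sum>j. (1/2)^j * v j x"
  shows "integrable M (\<lambda>x. (norm (u x))\<^sup>2)"
    and "\<lbrakk>e \<in> borel_measurable M; \<And>x. norm (e x) \<le> 1\<rbrakk> \<Longrightarrow> (\<lambda>j. (1/2)^j * (\<integral>x. v j x * e x \<partial>M)) sums (\<integral>x. u x * e x \<partial>M)"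
proof -
  interpret finite_measure M by fact
  have g: "summable (\<lambda>j. (1/2::real)^j)" by (simp add: summable_geometric)
  let ?f = "\<lambda>j x. (1/2)^j * (norm (v j x))\<^sup>2"
  have fint: "integrable M (?f j)" for j using sq by simp
  have fsum: "summable (\<lambda>j. \<integral>x. ?f j x \<partial>M)"
    by (rule summable_comparison_test'[OF summable_mult2[OF g, of C], where N=0])
       (auto intro!: mult_left_mono le integral_nonneg_AE)
  have ae: "AE x in M. summable (\<lambda>j. ?f j x)"
    by (rule AE_summable_of_summable_integrals[OF fint _ fsum]) auto
  have Gint: "integrable M (\<lambda>x. \<Sum>j. ?f j x)"
    using ae fsum by (intro integrable_suminf fint) (auto)
  have umeas[measurable]: "u \<in> borel_measurable M" unfolding u_def by measurable
  show "integrable M (\<lambda>x. (norm (u x))\<^sup>2)"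
  proof (rule Bochner_Integration.integrable_bound)
    show "integrable M (\<lambda>x. 2 * (\<Sum>j. ?f j x))" using Gint by simp
    show "AE x in M. norm ((norm (u x))\<^sup>2) \<le> norm (2 * (\<Sum>j. ?f j x))"
      using ae
    proof eventually_elim
      case (elim x)
      note j = jensen_geometric[of "\<lambda>j. norm (v j x)", OF _ elim, simplified]
      have s: "summable (\<lambda>j. norm ((1/2)^j * v j x))"
        using j(1) by (simp add: norm_mult norm_power norm_divide)
      have "norm (u x) \<le> (\<Sum>j. norm ((1/2)^j * v j x))"
        unfolding u_def by (rule summable_norm[OF s])
      then have "(norm (u x))\<^sup>2 \<le> (\<Sum>j. (1/2)^j * norm (v j x))\<^sup>2"
        by (intro power_mono) (simp_all add: norm_mult norm_power norm_divide)
      also have "\<dots> \<le> 2 * (\<Sum>j. ?f j x)" using j(2) by simp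
      finally show ?case by simp
    qed
  qed measurable
  assume [measurable]: "e \<in> borel_measurable M" and e: "\<And>x. norm (e x) \<le> 1"
  have nve: "norm (v j x * e x) \<le> 1 + (norm (v j x))\<^sup>2" for j x
  proof -
    have "norm (v j x * e x) \<le> norm (v j x)" using e[of x] by (simp add: norm_mult mult_left_le)
    also have "\<dots> \<le> 1 + (norm (v j x))\<^sup>2"
      using sum_squares_ge_zero[of "norm (v j x) - 1" "norm (v j x)"] by (simp add: power2_eq_square algebra_simps)
    finally show ?thesis .
  qed
  have ve: "integrable M (\<lambda>x. v j x * e x)" for j
    by (rule Bochner_Integration.integrable_bound[of _ "\<lambda>x. 1 + (norm (v j x))\<^sup>2"])
       (use nve[of j] sq in auto)
  have "(\<lambda>j. \<integral>x. (1/2)^j * (v j x * e x) \<partial>M) sums (\<integral>x. (\<Sum>j. (1/2)^j * (v j x * e x)) \<partial>M)"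
  proof (rule sums_integral)
    show "AE x in M. summable (\<lambda>j. norm ((1/2)^j * (v j x * e x)))"
      using ae
    proof eventually_elim
      case (elim x)
      note j = jensen_geometric(1)[of "\<lambda>j. norm (v j x)", OF _ elim, simplified]
      show ?case
        by (rule summable_comparison_test'[OF j, where N=0])
          (use e[of x] in \<open>auto simp: norm_mult norm_power norm_divide intro!: mult_left_le divide_right_mono\<close>)
    qed
    show "summable (\<lambda>j. \<integral>x. norm ((1/2)^j * (v j x * e x)) \<partial>M)"
    proof (rule summable_comparison_test'[OF summable_mult2[OF g, of "measure M (space M) + C"], where N=0])
      fix n :: nat
      have "(\<integral>x. norm (v n x * e x) \<partial>M) \<le> (\<integral>x. 1 + (norm (v n x))\<^sup>2 \<partial>M)"
        by (intro integral_mono integrable_norm ve nve) (use sq in auto)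
      also have "\<dots> \<le> measure M (space M) + C" using le[of n] sq by simp
      finally have "(1/2)^n * (\<integral>x. norm (v n x * e x) \<partial>M) \<le> (1/2)^n * (measure M (space M) + C)"
        by (intro mult_left_mono) auto
      then show "norm (\<integral>x. norm ((1/2)^n * (v n x * e x)) \<partial>M) \<le> (1/2)^n * (measure M (space M) + C)"
        by (simp add: norm_mult norm_power norm_divide)
    qed
  qed (use ve in auto)
  moreover have "AE x in M. (\<Sum>j. (1/2)^j * (v j x * e x)) = u x * e x"
    using ae
  proof eventually_elim
    case (elim x)
    note j = jensen_geometric(1)[of "\<lambda>j. norm (v j x)", OF _ elim, simplified]
    have "summable (\<lambda>j. (1/2)^j * v j x)"
      by (rule summable_norm_cancel) (use j in \<open>simp add: norm_mult norm_power norm_divide\<close>)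
    then show ?case by (simp add: u_def suminf_mult2 mult.assoc)
  qed
  then have "(\<integral>x. (\<Sum>j. (1/2)^j * (v j x * e x)) \<partial>M) = (\<integral>x. u x * e x \<partial>M)"
    by (intro integral_cong_AE) measurable
  ultimately show "(\<lambda>j. (1/2)^j * (\<integral>x. v j x * e x \<partial>M)) sums (\<integral>x. u x * e x \<partial>M)" by simp
qed

lemma torus_integral_restrict:
  "torus_integral f = of_real (1 / (2 * pi)) * (\<integral>x. f x \<partial>restrict_space lborel {0..2 * pi})"
  unfolding torus_integral_def set_lebesgue_integral_def
  by (subst integral_restrict_space) (auto simp: scaleR_conv_of_real)

lemma trig_poly_L2:
  fixes w :: "int \<Rightarrow> real"
  assumes "finite I"
  defines "v \<equiv> \<lambda>x. \<Sum>n\<in>I. of_real (w n) * cis (of_int n * x)"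
  shows "torus_integral (\<lambda>x. of_real ((norm (v x))\<^sup>2)) = of_real (\<Sum>n\<in>I. (w n)\<^sup>2)"
proof -
  have "of_real ((norm (v x))\<^sup>2) = (\<Sum>p\<in>I\<times>I. of_real (w (fst p) * w (snd p)) * cis (of_int (fst p - snd p) * x))" for x
  proof -
    have "of_real ((norm (v x))\<^sup>2) = v x * cnj (v x)" by (rule complex_norm_square)
    also have "\<dots> = (\<Sum>n\<in>I. \<Sum>m\<in>I. of_real (w n) * cis (of_int n * x) * (of_real (w m) * cis (- (of_int m * x))))"
      unfolding v_def cnj_sum sum_product by (simp add: cis_cnj)
    also have "\<dots> = (\<Sum>n\<in>I. \<Sum>m\<in>I. of_real (w n * w m) * cis (of_int (n - m) * x))"
    proof (intro sum.cong refl)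
      fix n m :: int
      have "cis (of_int (n - m) * x) = cis (of_int n * x) * cis (- (of_int m * x))"
        by (simp add: cis_mult left_diff_distrib)
      then show "of_real (w n) * cis (of_int n * x) * (of_real (w m) * cis (- (of_int m * x))) = of_real (w n * w m) * cis (of_int (n - m) * x)"
        by simp
    qed
    finally show ?thesis by (simp add: sum.cartesian_product case_prod_beta')
  qed
  then have "torus_integral (\<lambda>x. of_real ((norm (v x))\<^sup>2)) = (\<Sum>p\<in>I\<times>I. if fst p - snd p = 0 then of_real (w (fst p) * w (snd p)) else 0)"
    using torus_integral_trig[of "I \<times> I" "\<lambda>p. of_real (w (fst p) * w (snd p))" "\<lambda>p. fst p - snd p"] assms(1) by simp
  also have "\<dots> = (\<Sum>n\<in>I. \<Sum>m\<in>I. if m = n then of_real (w n * w m) else 0)"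
    unfolding sum.cartesian_product case_prod_beta' by (intro sum.cong refl) auto
  also have "\<dots> = of_real (\<Sum>n\<in>I. (w n)\<^sup>2)"
    using assms(1) by (simp add: power2_eq_square)
  finally show ?thesis .
qed

text \<open>The supports \<open>I j\<close> need not be disjoint: the coefficients of overlapping blocks add up.\<close>

lemma L2_torus_from_blocks:
  fixes w :: "nat \<Rightarrow> int \<Rightarrow> real" and I :: "nat \<Rightarrow> int set"
  assumes I: "\<And>j. finite (I j)" and supp: "\<And>j n. n \<notin> I j \<Longrightarrow> w j n = 0" and le: "\<And>j. (\<Sum>n\<in>I j. (w j n)\<^sup>2) \<le> 1"
  shows "\<exists>u\<in>L2_torus. \<forall>n. summable (\<lambda>j. (1/2)^j * w j n) \<and> fourier_coeff u n = of_real (\<Sum>j. (1/2)^j * w j n)"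
proof -
  let ?M = "restrict_space lborel {0..2 * pi}"
  define v where "v j x = (\<Sum>n\<in>I j. of_real (w j n) * cis (of_int n * x))" for j x
  define u where "u x = (\<Sum>j. (1/2)^j * v j x)" for x
  have cv: "continuous_on UNIV (v j)" for j unfolding v_def by (intro continuous_intros)
  have vb: "v j \<in> borel_measurable borel" for j using cv by (rule borel_measurable_continuous_onI)
  have vM: "v j \<in> borel_measurable ?M" for j using vb by (intro measurable_restrict_space1) simp
  have ub: "u \<in> borel_measurable borel" unfolding u_def using vb by measurable
  have fin: "finite_measure ?M"
    by (rule finite_measureI) (simp add: emeasure_restrict_space space_restrict_space)
  have sq: "integrable ?M (\<lambda>x. (norm (v j x))\<^sup>2)" for j
  proof -
    have "continuous_on UNIV (\<lambda>x. (norm (v j x))\<^sup>2)" using cv[of j] by (intro continuous_intros)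
    from set_integrable_continuous_torus[OF this] show ?thesis
      by (subst integrable_restrict_space) (auto simp: set_integrable_def)
  qed
  have "(\<integral>x. (norm (v j x))\<^sup>2 \<partial>?M) \<le> 2 * pi" for j
  proof -
    have "of_real (\<Sum>n\<in>I j. (w j n)\<^sup>2) = complex_of_real (1 / (2 * pi)) * (\<integral>x. of_real ((norm (v j x))\<^sup>2) \<partial>?M)"
      unfolding torus_integral_restrict[symmetric] v_def trig_poly_L2[OF I] ..
    then have "complex_of_real (\<Sum>n\<in>I j. (w j n)\<^sup>2) = of_real (1 / (2 * pi) * (\<integral>x. (norm (v j x))\<^sup>2 \<partial>?M))"
      unfolding integral_complex_of_real of_real_mult .
    then have "(\<integral>x. (norm (v j x))\<^sup>2 \<partial>?M) = 2 * pi * (\<Sum>n\<in>I j. (w j n)\<^sup>2)"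
      unfolding of_real_eq_iff by (simp add: field_simps)
    also have "\<dots> \<le> 2 * pi * 1" by (intro mult_left_mono le) simp
    finally show ?thesis by simp
  qed
  note series = L2_geometric_series[where v = v, OF fin vM sq this, folded u_def]
  have "u (x + 2 * pi) = u x" for x
  proof -
    have "cis (of_int n * (x + 2 * pi)) = cis (of_int n * x)" for n
      using cis_periodic[of "- n" x] by simp
    then show ?thesis by (simp add: u_def v_def)
  qed
  moreover have "set_integrable lborel {0..2 * pi} (\<lambda>x. (norm (u x))\<^sup>2)"
    using series(1) by (subst (asm) integrable_restrict_space) (auto simp: set_integrable_def)
  ultimately have "u \<in> L2_torus" using ub by (simp add: L2_torus_def)
  moreover have "(\<lambda>j. (1/2)^j * w j n) sums Re (fourier_coeff u n) \<and> fourier_coeff u n = of_real (\<Sum>j. (1/2)^j * w j n)" for n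
  proof -
    have em: "(\<lambda>x. cis (- (of_int n * x))) \<in> borel_measurable ?M"
      by (intro measurable_restrict_space1) (auto intro!: borel_measurable_continuous_onI continuous_intros)
    have "(\<lambda>j. (1/2)^j * (\<integral>x. v j x * cis (- (of_int n * x)) \<partial>?M)) sums (\<integral>x. u x * cis (- (of_int n * x)) \<partial>?M)"
      by (rule series(2)[OF em]) simp
    then have "(\<lambda>j. of_real (1 / (2 * pi)) * ((1/2)^j * (\<integral>x. v j x * cis (- (of_int n * x)) \<partial>?M))) sums fourier_coeff u n"
      unfolding fourier_coeff_def torus_integral_restrict by (rule sums_mult)
    moreover have "of_real (1 / (2 * pi)) * ((1/2)^j * (\<integral>x. v j x * cis (- (of_int n * x)) \<partial>?M)) = of_real ((1/2)^j * w j n)" for j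
    proof -
      have "of_real (1 / (2 * pi)) * ((1/2)^j * (\<integral>x. v j x * cis (- (of_int n * x)) \<partial>?M)) = (1/2)^j * fourier_coeff (v j) n"
        unfolding fourier_coeff_def torus_integral_restrict by simp
      also have "fourier_coeff (v j) n = of_real (w j n)"
        unfolding v_def fourier_coeff_trig_id[OF I] using supp by auto
      finally show ?thesis by simp
    qed
    ultimately have s: "(\<lambda>j. complex_of_real ((1/2)^j * w j n)) sums fourier_coeff u n" by simp
    then have r: "(\<lambda>j. (1/2)^j * w j n) sums Re (fourier_coeff u n)"
      using sums_Re[OF s] by simp
    moreover have "(\<lambda>j. complex_of_real ((1/2)^j * w j n)) sums of_real (Re (fourier_coeff u n))"
      using r by (rule sums_of_real)
    then have "fourier_coeff u n = of_real (Re (fourier_coeff u n))" using s sums_unique2 by blast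
    ultimately show ?thesis by (simp add: sums_iff)
  qed
  ultimately show ?thesis by (blast intro: sums_summable)
qed

section \<open>Fourier inversion on the line\<close>

text \<open>Rescaling reduces this to the characteristic function of the standard normal distribution.\<close>

lemma normal_fourier:
  assumes d: "\<delta> > 0"
  shows "(LBINT r. of_real (normal_density 0 \<delta> r) * cis (r * \<tau>)) = of_real (exp (- ((\<delta> * \<tau>)\<^sup>2 / 2)))"
proof -
  have "(LBINT r. of_real (normal_density 0 \<delta> r) * cis (r * \<tau>))
      = \<bar>\<delta>\<bar> *\<^sub>R (LBINT z. of_real (normal_density 0 \<delta> (0 + \<delta> * z)) * cis ((0 + \<delta> * z) * \<tau>))"
    using d by (intro lborel_integral_real_affine) auto
  also have "\<dots> = (LBINT z. of_real (std_normal_density z) * cis (z * (\<delta> * \<tau>)))"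
    using d by (subst integral_scaleR_right[symmetric], intro Bochner_Integration.integral_cong)
      (auto simp: normal_density_def scaleR_conv_of_real power_mult_distrib real_sqrt_mult mult_ac)
  also have "\<dots> = char std_normal_distribution (\<delta> * \<tau>)"
    unfolding char_def
    by (subst integral_density) (auto simp: cis_conv_exp scaleR_conv_of_real mult_ac)
  also have "\<dots> = of_real (exp (- ((\<delta> * \<tau>)\<^sup>2 / 2)))"
    by (simp add: char_std_normal_distribution)
  finally show ?thesis .
qed

lemma integrable_cis_mult:
  fixes h :: "real \<Rightarrow> complex"
  assumes "integrable lborel h"
  shows "integrable lborel (\<lambda>x. h x * cis (x * t))"
proof (rule Bochner_Integration.integrable_bound[OF integrable_norm[OF assms]])
  have [measurable]: "h \<in> borel_measurable lborel" using assms by auto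
  have [measurable]: "(\<lambda>x. cis (x * t)) \<in> borel_measurable borel"
    by (intro borel_measurable_continuous_onI continuous_intros)
  show "(\<lambda>x. h x * cis (x * t)) \<in> borel_measurable lborel" by measurable
qed (simp add: norm_mult)

text \<open>The iterated integral of \<open>h \<tau> * cis (t * (\<tau> + \<omega>))\<close> does not converge absolutely in \<open>(t, \<tau>)\<close>. With a
  damping factor \<open>exp (- (\<delta> t)\<^sup>2 / 2)\<close> Fubini applies, and the integral over \<open>t\<close> becomes a Gaussian density of
  width \<open>\<delta>\<close> around \<open>- \<omega>\<close>. As \<open>\<delta>\<close> tends to zero the damping disappears on one side,
  while on the other side the Gaussian averages of \<open>h\<close> tend to \<open>h (- \<omega>)\<close>.\<close>

lemma fourier_inversion:
  fixes h :: "real \<Rightarrow> complex"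
  assumes hint: "integrable lborel h" and hcont: "continuous_on UNIV h" and hb: "\<And>x. norm (h x) \<le> B"
  defines "K \<equiv> \<lambda>t. LBINT \<tau>. h \<tau> * cis (t * \<tau>)"
  assumes Kint: "integrable lborel K"
  shows "(LBINT t. K t * cis (t * \<omega>)) = 2 * pi * h (- \<omega>)"
proof -
  have [measurable]: "h \<in> borel_measurable borel" using hint by auto
  have [measurable]: "K \<in> borel_measurable borel" using Kint by auto
  have cism[measurable]: "(\<lambda>x. cis (f x)) \<in> borel_measurable M" if "f \<in> borel_measurable M" for f and M :: "'b measure"
    using that by (rule measurable_compose) (intro borel_measurable_continuous_onI continuous_intros)
  define \<delta> where "\<delta> j = 1 / (real (Suc j))" for j
  have \<delta>: "\<delta> j > 0" for j by (simp add: \<delta>_def)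
  have \<delta>0: "\<delta> \<longlonglongrightarrow> 0" unfolding \<delta>_def by (rule lim_1_over_n[THEN LIMSEQ_Suc])
  define G where "G j t = exp (- ((\<delta> j * t)\<^sup>2 / 2))" for j and t :: real
  have Gnorm: "G j t = sqrt (2 * pi) / \<delta> j * normal_density 0 (1 / \<delta> j) t" for j t
    using \<delta>[of j] by (simp add: G_def normal_density_def real_sqrt_mult real_sqrt_divide power_mult_distrib field_simps)
  have Gint: "integrable lborel (G j)" for j
    unfolding Gnorm[abs_def] using \<delta>[of j] by (intro integrable_mult_right integrable_normal_density) auto
  have [measurable]: "G j \<in> borel_measurable borel" for j using Gint[of j] by auto
  have key: "(LBINT t. of_real (G j t) * (K t * cis (t * \<omega>)))
     = (LBINT z. 2 * pi * of_real (std_normal_density z) * h (- \<omega> + \<delta> j * z))" for j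
  proof -
    have Gc: "(LBINT t. of_real (G j t) * cis (t * y)) = of_real (2 * pi * normal_density 0 (\<delta> j) y)" for y
    proof -
      have "(LBINT t. of_real (G j t) * cis (t * y)) =
         of_real (sqrt (2 * pi) / \<delta> j) * (LBINT t. of_real (normal_density 0 (1 / \<delta> j) t) * cis (t * y))"
        by (simp add: Gnorm mult.assoc)
      also have "\<dots> = of_real (sqrt (2 * pi) / \<delta> j * exp (- ((1 / \<delta> j * y)\<^sup>2 / 2)))"
        by (subst normal_fourier) (use \<delta>[of j] in auto)
      also have "sqrt (2 * pi) / \<delta> j * exp (- ((1 / \<delta> j * y)\<^sup>2 / 2)) = 2 * pi * normal_density 0 (\<delta> j) y"
      proof -
        have "sqrt (2*pi) * sqrt (2*pi) = 2 * pi" by simp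
        then show ?thesis
          using \<delta>[of j] by (simp add: normal_density_def real_sqrt_mult power_divide field_simps)
      qed
      finally show ?thesis .
    qed
    have "(LBINT t. of_real (G j t) * (K t * cis (t * \<omega>)))
       = (LBINT t. LBINT \<tau>. of_real (G j t) * h \<tau> * cis (t * (\<tau> + \<omega>)))"
    proof (intro Bochner_Integration.integral_cong refl)
      fix t
      have "of_real (G j t) * (K t * cis (t * \<omega>)) = (of_real (G j t) * cis (t * \<omega>)) * (LBINT \<tau>. h \<tau> * cis (t * \<tau>))"
        by (simp add: K_def mult_ac)
      also have "\<dots> = (LBINT \<tau>. (of_real (G j t) * cis (t * \<omega>)) * (h \<tau> * cis (t * \<tau>)))"
        by (rule integral_mult_right_zero[symmetric])
      also have "\<dots> = (LBINT \<tau>. of_real (G j t) * h \<tau> * cis (t * (\<tau> + \<omega>)))"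
        by (intro Bochner_Integration.integral_cong refl) (simp add: distrib_left flip: cis_mult)
      finally show "of_real (G j t) * (K t * cis (t * \<omega>)) = (LBINT \<tau>. of_real (G j t) * h \<tau> * cis (t * (\<tau> + \<omega>)))" .
    qed
    also have "\<dots> = (LBINT \<tau>. LBINT t. of_real (G j t) * h \<tau> * cis (t * (\<tau> + \<omega>)))"
    proof (rule lborel_pair.Fubini_integral)
      have "integrable (lborel \<Otimes>\<^sub>M lborel) (\<lambda>(x, y). G j y * norm (h x))"
      proof (rule lborel_pair.Fubini_integrable)
        show "AE x in lborel. integrable lborel (\<lambda>y. case (x, y) of (x, y) \<Rightarrow> G j y * norm (h x))"
          using Gint[of j] by auto
        show "integrable lborel (\<lambda>x. LBINT y. norm (case (x, y) of (x, y) \<Rightarrow> G j y * norm (h x)))"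
          using hint by (simp add: abs_mult G_def)
      qed measurable
      then show "integrable (lborel \<Otimes>\<^sub>M lborel) (\<lambda>(\<tau>, t). of_real (G j t) * h \<tau> * cis (t * (\<tau> + \<omega>)))"
        by (rule Bochner_Integration.integrable_bound) (auto simp: norm_mult G_def)
    qed
    also have "\<dots> = (LBINT \<tau>. h \<tau> * of_real (2 * pi * normal_density 0 (\<delta> j) (\<tau> + \<omega>)))"
      unfolding Gc[symmetric] by (simp add: mult_ac)
    also have "\<dots> = \<bar>\<delta> j\<bar> *\<^sub>R (LBINT z. h (-\<omega> + \<delta> j * z) * of_real (2 * pi * normal_density 0 (\<delta> j) (- \<omega> + \<delta> j * z + \<omega>)))"
      using \<delta>[of j] by (intro lborel_integral_real_affine) auto
    also have "\<dots> = (LBINT z. 2 * pi * of_real (std_normal_density z) * h (- \<omega> + \<delta> j * z))"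
      using \<delta>[of j] by (subst integral_scaleR_right[symmetric], intro Bochner_Integration.integral_cong)
        (auto simp: normal_density_def scaleR_conv_of_real power_mult_distrib real_sqrt_mult field_simps)
    finally show ?thesis .
  qed
  \<comment> \<open>Removing the damping: dominated by \<open>K\<close>, which is where its integrability enters.\<close>
  have lim1: "(\<lambda>j. LBINT t. of_real (G j t) * (K t * cis (t * \<omega>))) \<longlonglongrightarrow> (LBINT t. K t * cis (t * \<omega>))"
  proof (rule integral_dominated_convergence)
    show "integrable lborel (\<lambda>t. norm (K t))" using Kint by simp
    show "AE t in lborel. (\<lambda>j. of_real (G j t) * (K t * cis (t * \<omega>))) \<longlonglongrightarrow> K t * cis (t * \<omega>)"
    proof (rule AE_I2)
      fix t
      have "(\<lambda>j. of_real (G j t) * (K t * cis (t * \<omega>))) \<longlonglongrightarrow> of_real (exp (- ((0 * t)\<^sup>2 / 2))) * (K t * cis (t * \<omega>))"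
        unfolding G_def by (intro tendsto_intros \<delta>0) simp
      then show "(\<lambda>j. of_real (G j t) * (K t * cis (t * \<omega>))) \<longlonglongrightarrow> K t * cis (t * \<omega>)" by simp
    qed
    show "AE x in lborel. norm (complex_of_real (G i x) * (K x * cis (x * \<omega>))) \<le> norm (K x)" for i
      by (auto simp: norm_mult G_def intro!: mult_left_le_one_le)
  qed measurable
  \<comment> \<open>After rescaling, the Gaussian is fixed and the argument of \<open>h\<close> converges to \<open>- \<omega>\<close>.\<close>
  have lim2: "(\<lambda>j. LBINT z. 2 * pi * of_real (std_normal_density z) * h (- \<omega> + \<delta> j * z)) \<longlonglongrightarrow>
      (LBINT z. 2 * pi * of_real (std_normal_density z) * h (- \<omega>))"
  proof (rule integral_dominated_convergence)
    show "integrable lborel (\<lambda>z. 2 * pi * std_normal_density z * B)"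
      by (intro integrable_mult_left integrable_mult_right) simp
    show "AE z in lborel. (\<lambda>j. 2 * pi * of_real (std_normal_density z) * h (- \<omega> + \<delta> j * z)) \<longlonglongrightarrow> 2 * pi * of_real (std_normal_density z) * h (- \<omega>)"
    proof (rule AE_I2)
      fix z
      have "(\<lambda>j. - \<omega> + \<delta> j * z) \<longlonglongrightarrow> - \<omega> + 0 * z" by (intro tendsto_intros \<delta>0)
      then have "(\<lambda>j. h (- \<omega> + \<delta> j * z)) \<longlonglongrightarrow> h (- \<omega>)"
        using hcont by (intro continuous_on_tendsto_compose[OF hcont]) auto
      then show "(\<lambda>j. 2 * pi * of_real (std_normal_density z) * h (- \<omega> + \<delta> j * z)) \<longlonglongrightarrow> 2 * pi * of_real (std_normal_density z) * h (- \<omega>)"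
        by (rule tendsto_mult_left)
    qed
    show "AE z in lborel. norm (2 * pi * of_real (std_normal_density z) * h (- \<omega> + \<delta> i * z)) \<le> 2 * pi * std_normal_density z * B" for i
      using hb by (auto simp: norm_mult intro!: mult_left_mono)
  qed measurable
  have "(LBINT z. 2 * pi * of_real (std_normal_density z) * h (- \<omega>)) = 2 * pi * h (- \<omega>)"
    by simp
  then show ?thesis
    using LIMSEQ_unique[OF lim1[unfolded key] lim2] by (rule trans[rotated])
qed

section \<open>Multipliers applied to Gaussians\<close>

lemma integrable_inverse_square:
  "integrable lborel (\<lambda>x. C / (1 + x\<^sup>2) :: real)"
proof -
  have "integrable lborel (\<lambda>x. C * inverse (1 + x\<^sup>2) :: real)"
    using integrable_inverse_1_plus_square
    by (intro integrable_mult_right) (simp add: set_integrable_def einterval_eq)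
  then show ?thesis by (simp add: divide_inverse)
qed

lemma integrable_quadratic_decay:
  fixes f :: "real \<Rightarrow> complex"
  assumes "continuous_on UNIV f" "\<And>x. norm (f x) \<le> C / (1 + x\<^sup>2)"
  shows "integrable lborel f"
proof (rule Bochner_Integration.integrable_bound[OF integrable_inverse_square])
  show "f \<in> borel_measurable lborel"
    using assms(1) by (simp add: borel_measurable_continuous_onI)
  show "AE x in lborel. norm (f x) \<le> norm (C / (1 + x\<^sup>2))"
    by (intro AE_I2 order_trans[OF assms(2)]) (simp only: real_norm_def abs_ge_self)
qed

text \<open>Integration by parts on the whole line, in the form in which it is applied to kernels of multipliers. The
  quadratic decay serves both for integrability and for vanishing at infinity.\<close>

lemma integral_of_derivative_eq_0:
  fixes F :: "real \<Rightarrow> complex"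
  assumes der: "\<And>x. (F has_vector_derivative f x) (at x)" and cont: "continuous_on UNIV f"
    and f: "\<And>x. norm (f x) \<le> C / (1 + x\<^sup>2)" and F: "\<And>x. norm (F x) \<le> C / (1 + x\<^sup>2)"
  shows "(LBINT x. f x) = 0"
proof -
  have "((\<lambda>x. C / (1 + x\<^sup>2)) \<longlongrightarrow> 0) at_top" "((\<lambda>x. C / (1 + x\<^sup>2)) \<longlongrightarrow> 0) at_bot"
    by real_asymp+
  then have lims: "(F \<longlongrightarrow> 0) at_top" "(F \<longlongrightarrow> 0) at_bot"
    by (auto intro: Lim_null_comparison[OF always_eventually, rule_format, OF F])
  have "(LBINT x=-\<infinity>..\<infinity>. f x) = 0 - 0"
    by (rule interval_integral_FTC_integrable[where F=F])
       (use der cont lims integrable_quadratic_decay[OF cont f] in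
        \<open>auto simp: ereal_tendsto_simps set_integrable_def einterval_eq continuous_on_eq_continuous_at\<close>)
  then show ?thesis
    by (simp add: interval_lebesgue_integral_def set_lebesgue_integral_def einterval_eq)
qed

lemma DERIV_gaussian: "((\<lambda>t. exp (- (a * t\<^sup>2))) has_real_derivative exp (- (a * t\<^sup>2)) * (- (a * (2 * t)))) (at t)"
  by (auto intro!: derivative_eq_intros)

text \<open>A single term of the exponential series, \<open>y\<^sup>n / n! \<le> exp y\<close>, at \<open>y = a (1 + t\<^sup>2)\<close>.\<close>

lemma power_times_gaussian_bounded:
  assumes "a > (0::real)"
  obtains C where "\<And>t. (1 + t\<^sup>2) ^ n * exp (- (a * t\<^sup>2)) \<le> C"
proof
  fix t :: real
  define y where "y = a * (1 + t\<^sup>2)"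
  have y: "y \<ge> 0" using assms by (simp add: y_def)
  have "(\<Sum>k\<in>{n}. inverse (fact k) * y ^ k) \<le> (\<Sum>k. inverse (fact k) * y ^ k)"
    using y by (intro sum_le_suminf summable_exp) auto
  then have "y ^ n \<le> fact n * exp y"
    by (simp add: exp_def field_simps)
  also have "exp y = exp a * exp (a * t\<^sup>2)" by (simp add: y_def distrib_left exp_add)
  finally have "a ^ n * (1 + t\<^sup>2) ^ n \<le> fact n * exp a * exp (a * t\<^sup>2)"
    by (simp add: y_def power_mult_distrib)
  then show "(1 + t\<^sup>2) ^ n * exp (- (a * t\<^sup>2)) \<le> fact n * exp a / a ^ n"
    using assms by (simp add: exp_minus field_simps)
qed

text \<open>These are the hypotheses of Fourier inversion for \<open>h\<close>. Only the integrability of the transform \<open>K\<close> has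
  content: \<open>h\<close> and its first two derivatives decay at least quadratically, so two integrations by parts give
  \<open>(1 + t\<^sup>2) K t = \<integral> (h - h'') e\<^bsup>i t \<tau>\<^esup> d\<tau>\<close>, whence \<open>K\<close> decays quadratically.\<close>

lemma gaussian_multiplier_kernel_integrable:
  fixes q a :: real
  assumes a: "a > 0"
  defines "h \<equiv> \<lambda>\<tau>. (1 + \<tau>\<^sup>2) powr q * exp (- (a * \<tau>\<^sup>2))"
  defines "K \<equiv> \<lambda>t. LBINT \<tau>. of_real (h \<tau>) * cis (t * \<tau>)"
  shows "integrable lborel (\<lambda>\<tau>. complex_of_real (h \<tau>))" and "continuous_on UNIV (\<lambda>\<tau>. complex_of_real (h \<tau>))"
    and "\<exists>B. \<forall>\<tau>. norm (complex_of_real (h \<tau>)) \<le> B" and "integrable lborel K"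
proof -
  have pos0: "0 < 1 + \<tau>\<^sup>2" for \<tau> :: real
    by (rule add_pos_nonneg[OF zero_less_one zero_le_power2])
  have pos1: "1 + \<tau>\<^sup>2 \<ge> 1" for \<tau> :: real by simp
  note pos = pos0 pos1 less_imp_neq[OF pos0, symmetric]
  \<comment> \<open>The logarithmic derivative of \<open>h\<close> and its derivative, so that \<open>h' = h l\<close> and \<open>h'' = h (l\<^sup>2 + l')\<close>.\<close>
  define l where "l \<tau> = 2 * q * \<tau> / (1 + \<tau>\<^sup>2) - 2 * a * \<tau>" for \<tau>
  define l' where "l' \<tau> = 2 * q / (1 + \<tau>\<^sup>2) - 4 * q * \<tau>\<^sup>2 / (1 + \<tau>\<^sup>2)\<^sup>2 - 2 * a" for \<tau>
  have h0: "h \<tau> > 0" for \<tau>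
    unfolding h_def by (intro mult_pos_pos powr_gt_zero[THEN iffD2] pos(3) exp_gt_zero)
  have dh: "(h has_real_derivative h \<tau> * l \<tau>) (at \<tau>)" for \<tau>
  proof -
    have e: "(1 + \<tau>\<^sup>2) powr (q - 1) = (1 + \<tau>\<^sup>2) powr q / (1 + \<tau>\<^sup>2)"
      using pos(1)[of \<tau>] by (simp add: powr_diff)
    have "((\<lambda>\<tau>. 1 + \<tau>\<^sup>2) has_real_derivative 2 * \<tau>) (at \<tau>)"
      by (auto intro!: derivative_eq_intros)
    from DERIV_fun_powr[OF this pos(1), of q]
    have p: "((\<lambda>\<tau>. (1 + \<tau>\<^sup>2) powr q) has_real_derivative q * ((1 + \<tau>\<^sup>2) powr q / (1 + \<tau>\<^sup>2)) * (2 * \<tau>)) (at \<tau>)"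
      by (simp only: e of_nat_1)
    show ?thesis
      unfolding h_def l_def by (rule DERIV_cong[OF DERIV_mult[OF p DERIV_gaussian]]) (simp add: algebra_simps)
  qed
  have dl: "(l has_real_derivative l' \<tau>) (at \<tau>)" for \<tau>
  proof -
    have "((\<lambda>\<tau>. 1 + \<tau>\<^sup>2) has_real_derivative 2 * \<tau>) (at \<tau>)" "((\<lambda>\<tau>. 2 * q * \<tau>) has_real_derivative 2 * q) (at \<tau>)"
      "((\<lambda>\<tau>. 2 * a * \<tau>) has_real_derivative 2 * a) (at \<tau>)"
      by (auto intro!: derivative_eq_intros)
    from DERIV_diff[OF DERIV_divide[OF this(2) this(1) pos(3)] this(3)]
    have "(l has_real_derivative (2 * q * (1 + \<tau>\<^sup>2) - 2 * q * \<tau> * (2 * \<tau>)) / ((1 + \<tau>\<^sup>2) * (1 + \<tau>\<^sup>2)) - 2 * a) (at \<tau>)"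
      unfolding l_def by simp
    moreover have "(2 * q * X - 2 * q * \<tau> * (2 * \<tau>)) / (X * X) = 2 * q / X - 4 * q * \<tau>\<^sup>2 / X\<^sup>2" if "X \<noteq> 0" for X
      using that by (simp add: divide_simps power2_eq_square algebra_simps)
    ultimately show ?thesis unfolding l'_def using pos(3) by simp
  qed
  have ch: "continuous_on UNIV h" "continuous_on UNIV l"
    using dh dl by (auto intro!: DERIV_isCont continuous_at_imp_continuous_on)
  have cl': "continuous_on UNIV l'"
    unfolding l'_def using pos by (intro continuous_intros) auto
  show ch': "continuous_on UNIV (\<lambda>\<tau>. complex_of_real (h \<tau>))"
    using ch(1) by (intro continuous_intros)
  define D where "D = 2 * \<bar>q\<bar> + 4 * \<bar>q\<bar> + 2 * a"
  have D: "D \<ge> 0" using a by (simp add: D_def)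
  define X where "X \<tau> = 1 + \<tau>\<^sup>2" for \<tau> :: real
  have X: "X \<tau> > 0" "X \<tau> \<ge> 1" for \<tau> unfolding X_def by (rule pos)+
  have t: "\<bar>\<tau>\<bar> \<le> X \<tau>" for \<tau> unfolding X_def by (rule abs_le_one_plus_square)
  have X2: "1 \<le> (X \<tau>)\<^sup>2" "X \<tau> \<le> (X \<tau>)\<^sup>2" for \<tau>
    using one_le_power[OF X(2)[of \<tau>], of 2] mult_left_mono[OF X(2)[of \<tau>] less_imp_le[OF X(1)], of \<tau>] by (simp_all only: power2_eq_square mult_1_right)
  have t2: "\<tau>\<^sup>2 \<le> (X \<tau>)\<^sup>2" for \<tau>
    using X2(2)[of \<tau>] unfolding X_def by linarith
  have l: "\<bar>l \<tau>\<bar> \<le> D * X \<tau>" for \<tau>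
  proof -
    have "\<bar>l \<tau>\<bar> \<le> \<bar>2 * q * \<tau> / X \<tau>\<bar> + \<bar>2 * a * \<tau>\<bar>" unfolding l_def X_def by (rule abs_triangle_ineq4)
    also have "\<bar>2 * q * \<tau> / X \<tau>\<bar> = 2 * \<bar>q\<bar> * (\<bar>\<tau>\<bar> / X \<tau>)"
      using X(1)[of \<tau>] by (simp add: abs_mult)
    also have "\<dots> \<le> 2 * \<bar>q\<bar> * X \<tau>"
      using X[of \<tau>] t[of \<tau>] by (intro mult_left_mono order_trans[OF _ X(2)]) (auto simp: divide_le_eq)
    also have "\<bar>2 * a * \<tau>\<bar> \<le> 2 * a * X \<tau>" using t[of \<tau>] a by (simp add: abs_mult)
    finally have "\<bar>l \<tau>\<bar> \<le> (2 * \<bar>q\<bar> + 2 * a) * X \<tau>" by (simp add: algebra_simps)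
    also have "\<dots> \<le> D * X \<tau>" unfolding D_def using X(1)[of \<tau>] by (intro mult_right_mono) auto
    finally show ?thesis .
  qed
  have l': "\<bar>l' \<tau>\<bar> \<le> D" for \<tau>
  proof -
    have "2 * \<bar>q\<bar> * (1 / X \<tau>) \<le> 2 * \<bar>q\<bar> * 1"
      using X[of \<tau>] by (intro mult_left_mono) (auto simp: divide_le_eq)
    then have "\<bar>2 * q / X \<tau>\<bar> \<le> 2 * \<bar>q\<bar>" using X(1)[of \<tau>] by (simp add: abs_mult)
    moreover have "4 * \<bar>q\<bar> * (\<tau>\<^sup>2 / (X \<tau>)\<^sup>2) \<le> 4 * \<bar>q\<bar> * 1"
      using X(1)[of \<tau>] t2[of \<tau>] by (intro mult_left_mono) (auto simp: divide_le_eq)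
    then have "\<bar>4 * q * \<tau>\<^sup>2 / (X \<tau>)\<^sup>2\<bar> \<le> 4 * \<bar>q\<bar>"
      by (simp add: abs_mult)
    ultimately show ?thesis unfolding l'_def X_def[symmetric] D_def using a by linarith
  qed
  obtain m :: nat where m: "\<bar>q\<bar> \<le> real m" using real_arch_simple by blast
  obtain C where C: "\<And>t. (X t) ^ (m + 3) * exp (- (a * t\<^sup>2)) \<le> C"
    using power_times_gaussian_bounded[OF a] unfolding X_def by blast
  have hC: "h \<tau> * (X \<tau>)\<^sup>2 \<le> C / X \<tau>" for \<tau>
  proof -
    have "(X \<tau>) powr q \<le> (X \<tau>) powr (real m)" using X[of \<tau>] m by (intro powr_mono) auto
    then have "h \<tau> \<le> (X \<tau>) ^ m * exp (- (a * \<tau>\<^sup>2))"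
      unfolding h_def X_def[symmetric] using X[of \<tau>] by (intro mult_right_mono) (auto simp: powr_realpow)
    then have "h \<tau> * (X \<tau>) ^ 3 \<le> (X \<tau>) ^ m * exp (- (a * \<tau>\<^sup>2)) * (X \<tau>) ^ 3"
      using X[of \<tau>] by (intro mult_right_mono) auto
    also have "\<dots> \<le> C" using C[of \<tau>] by (simp add: power_add mult_ac)
    finally show ?thesis using X[of \<tau>] by (simp add: pos_le_divide_eq power2_eq_square power3_eq_cube mult.assoc)
  qed
  have b0': "h \<tau> \<le> C / X \<tau>" for \<tau>
    using hC[of \<tau>] mult_left_mono[OF X2(1)[of \<tau>] less_imp_le[OF h0[of \<tau>]]] by linarith
  have b1': "\<bar>h \<tau> * l \<tau>\<bar> \<le> D * (C / X \<tau>)" for \<tau>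
  proof -
    have "\<bar>l \<tau>\<bar> \<le> D * (X \<tau>)\<^sup>2" using l[of \<tau>] mult_left_mono[OF X2(2)[of \<tau>] D] by linarith
    then have "\<bar>h \<tau> * l \<tau>\<bar> \<le> h \<tau> * (D * (X \<tau>)\<^sup>2)"
      using h0[of \<tau>] by (simp add: abs_mult)
    also have "\<dots> \<le> D * (C / X \<tau>)" using mult_left_mono[OF hC[of \<tau>] D] by (simp add: mult_ac)
    finally show ?thesis .
  qed
  have b2': "\<bar>h \<tau> * ((l \<tau>)\<^sup>2 + l' \<tau>)\<bar> \<le> (D\<^sup>2 + D) * (C / X \<tau>)" for \<tau>
  proof -
    have "\<bar>l \<tau>\<bar>\<^sup>2 \<le> (D * X \<tau>)\<^sup>2" by (rule power_mono[OF l]) simp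
    then have "(l \<tau>)\<^sup>2 \<le> D\<^sup>2 * (X \<tau>)\<^sup>2" by (simp add: power_mult_distrib)
    moreover have "\<bar>l' \<tau>\<bar> \<le> D * (X \<tau>)\<^sup>2"
      using l'[of \<tau>] mult_left_mono[OF X2(1)[of \<tau>] D] by simp
    ultimately have "\<bar>(l \<tau>)\<^sup>2 + l' \<tau>\<bar> \<le> (D\<^sup>2 + D) * (X \<tau>)\<^sup>2"
      using zero_le_power2[of "l \<tau>"] abs_triangle_ineq[of "(l \<tau>)\<^sup>2" "l' \<tau>"] unfolding distrib_right abs_power2 by linarith
    then have "\<bar>h \<tau> * ((l \<tau>)\<^sup>2 + l' \<tau>)\<bar> \<le> h \<tau> * ((D\<^sup>2 + D) * (X \<tau>)\<^sup>2)"
      using h0[of \<tau>] by (simp add: abs_mult)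
    also have "\<dots> = (D\<^sup>2 + D) * (h \<tau> * (X \<tau>)\<^sup>2)" by simp
    also have "\<dots> \<le> (D\<^sup>2 + D) * (C / X \<tau>)" using D by (intro mult_left_mono[OF hC]) auto
    finally show ?thesis .
  qed
  note b0 = b0'[unfolded X_def] and b1 = b1'[unfolded X_def] and b2 = b2'[unfolded X_def]
  have C0: "C \<ge> 0" using b0[of 0] h0[of 0] by simp
  have CX: "0 \<le> C / (1 + \<tau>\<^sup>2)" for \<tau> using b0[of \<tau>] h0[of \<tau>] by linarith
  show "integrable lborel (\<lambda>\<tau>. complex_of_real (h \<tau>))"
    by (rule integrable_quadratic_decay[OF ch', of C]) (use b0 h0 in \<open>simp add: less_imp_le\<close>)
  note hint = this
  have "h \<tau> \<le> C" for \<tau>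
    using b0'[of \<tau>] frac_le[OF C0 order_refl zero_less_one X(2)[of \<tau>]] by simp
  then show "\<exists>B. \<forall>\<tau>. norm (complex_of_real (h \<tau>)) \<le> B"
    using h0 by (intro exI[of _ C]) (simp add: less_imp_le)
  define h2 where "h2 \<tau> = h \<tau> * ((l \<tau>)\<^sup>2 + l' \<tau>)" for \<tau>
 have b2h: "\<bar>h2 \<tau>\<bar> \<le> (D\<^sup>2 + D) * C / (1 + \<tau>\<^sup>2)" for \<tau>
    using b2[of \<tau>] unfolding h2_def times_divide_eq_right .
  have ch2: "continuous_on UNIV h2" unfolding h2_def using ch cl' by (intro continuous_intros)
  have parts: "(LBINT \<tau>. of_real (h2 \<tau>) * cis (t * \<tau>)) = - (of_real (t\<^sup>2) * K t)" for t
  proof -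
    \<comment> \<open>Both integrations by parts at once: the derivative of \<open>(h' - i t h) e\<^bsup>i t \<tau>\<^esup>\<close> is \<open>(h'' + t\<^sup>2 h) e\<^bsup>i t \<tau>\<^esup>\<close>.\<close>
    define F where "F \<tau> = (of_real (h \<tau> * l \<tau>) - \<i> * of_real t * of_real (h \<tau>)) * cis (t * \<tau>)" for \<tau>
    define f where "f \<tau> = (of_real (h2 \<tau>) + of_real (t\<^sup>2) * of_real (h \<tau>)) * cis (t * \<tau>)" for \<tau>
    have dhl: "((\<lambda>\<tau>. h \<tau> * l \<tau>) has_real_derivative h2 \<tau>) (at \<tau>)" for \<tau>
      unfolding h2_def
      by (auto intro!: derivative_eq_intros dh dl simp: power2_eq_square algebra_simps)
    have der: "(F has_vector_derivative f \<tau>) (at \<tau>)" for \<tau>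
    proof -
      have c: "((\<lambda>\<tau>. cis (t * \<tau>)) has_vector_derivative (of_real t * \<i> * cis (t * \<tau>))) (at \<tau>)"
        by (rule cis_has_vector_derivative) (auto intro!: derivative_eq_intros)
      have "((\<lambda>\<tau>. of_real (h \<tau> * l \<tau>) - \<i> * of_real t * of_real (h \<tau>)) has_vector_derivative
         (of_real (h2 \<tau>) - \<i> * of_real t * of_real (h \<tau> * l \<tau>))) (at \<tau>)"
        by (intro has_vector_derivative_diff has_vector_derivative_mult_right has_vector_derivative_of_real dh dhl)
      from has_vector_derivative_mult[OF this c] show ?thesis
        unfolding F_def f_def by (rule has_vector_derivative_eq_rhs) (simp add: power2_eq_square algebra_simps)
    qed
    let ?C = "(D\<^sup>2 + D + t\<^sup>2 + \<bar>t\<bar>) * C"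
    have "(LBINT \<tau>. f \<tau>) = 0"
    proof (rule integral_of_derivative_eq_0[OF der])
      show "continuous_on UNIV f" unfolding f_def using ch ch2 by (intro continuous_intros)
      show "norm (f \<tau>) \<le> ?C / (1 + \<tau>\<^sup>2)" for \<tau>
      proof -
        have "norm (f \<tau>) = \<bar>h2 \<tau> + t\<^sup>2 * h \<tau>\<bar>"
          unfolding f_def norm_mult
            by (simp only: of_real_mult[symmetric] of_real_add[symmetric] norm_of_real norm_cis mult_1_right)
        also have "\<dots> \<le> \<bar>h2 \<tau>\<bar> + t\<^sup>2 * h \<tau>" using h0[of \<tau>] by (simp add: abs_mult order_trans[OF abs_triangle_ineq])
        also have "\<dots> \<le> (D\<^sup>2 + D) * (C / (1 + \<tau>\<^sup>2)) + t\<^sup>2 * (C / (1 + \<tau>\<^sup>2)) + \<bar>t\<bar> * (C / (1 + \<tau>\<^sup>2))"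
          using b2[of \<tau>] mult_left_mono[OF b0[of \<tau>] zero_le_power2[of t]]
            mult_nonneg_nonneg[OF abs_ge_zero[of t] CX[of \<tau>]] unfolding h2_def by linarith
        also have "\<dots> = ?C / (1 + \<tau>\<^sup>2)" by (simp add: algebra_simps add_divide_distrib)
        finally show ?thesis .
      qed
      show "norm (F \<tau>) \<le> ?C / (1 + \<tau>\<^sup>2)" for \<tau>
      proof -
        have "norm (F \<tau>) \<le> \<bar>h \<tau> * l \<tau>\<bar> + \<bar>t\<bar> * h \<tau>"
          unfolding F_def norm_mult using h0[of \<tau>] norm_triangle_ineq4[of "of_real (h \<tau> * l \<tau>)" "\<i> * of_real t * of_real (h \<tau>)"]
          by (simp add: norm_mult)
        also have "\<dots> \<le> D * (C / (1 + \<tau>\<^sup>2)) + \<bar>t\<bar> * (C / (1 + \<tau>\<^sup>2)) + (D\<^sup>2 + t\<^sup>2) * (C / (1 + \<tau>\<^sup>2))"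
          using b1[of \<tau>] mult_left_mono[OF b0[of \<tau>] abs_ge_zero[of t]]
            mult_nonneg_nonneg[OF add_nonneg_nonneg[OF zero_le_power2[of D] zero_le_power2[of t]] CX[of \<tau>]] by linarith
        also have "\<dots> = ?C / (1 + \<tau>\<^sup>2)" by (simp add: algebra_simps add_divide_distrib)
        finally show ?thesis .
      qed
    qed
    moreover have "(LBINT \<tau>. f \<tau>) = (LBINT \<tau>. of_real (h2 \<tau>) * cis (t * \<tau>)) + of_real (t\<^sup>2) * K t"
    proof -
      have i1: "integrable lborel (\<lambda>\<tau>. of_real (h2 \<tau>) * cis (t * \<tau>))"
      proof (rule integrable_quadratic_decay[of _ "(D\<^sup>2 + D) * C"])
        show "continuous_on UNIV (\<lambda>\<tau>. of_real (h2 \<tau>) * cis (t * \<tau>))" using ch2 by (intro continuous_intros)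
      qed (use b2h in \<open>simp add: norm_mult\<close>)
      have i2: "integrable lborel (\<lambda>\<tau>. of_real (h \<tau>) * cis (t * \<tau>))"
      proof (rule integrable_quadratic_decay[of _ "C"])
        show "continuous_on UNIV (\<lambda>\<tau>. of_real (h \<tau>) * cis (t * \<tau>))" using ch by (intro continuous_intros)
      qed (use b0 h0 in \<open>simp add: norm_mult less_imp_le\<close>)
      show ?thesis unfolding f_def K_def distrib_right mult.assoc
        by (subst Bochner_Integration.integral_add) (use i1 i2 in \<open>auto intro!: integrable_mult_right\<close>)
    qed
    ultimately show ?thesis by (simp add: eq_neg_iff_add_eq_0)
  qed
  define C' where "C' = (LBINT x. (D\<^sup>2 + D + 1) * C / (1 + x\<^sup>2))"
  have Kb: "norm (K t) \<le> C' / (1 + t\<^sup>2)" for t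
  proof -
    have "of_real (1 + t\<^sup>2) * K t = K t - (LBINT \<tau>. of_real (h2 \<tau>) * cis (t * \<tau>))"
      unfolding parts by (simp add: algebra_simps)
    also have "norm \<dots> \<le> (LBINT \<tau>. C / (1 + \<tau>\<^sup>2)) + (LBINT \<tau>. (D\<^sup>2 + D) * C / (1 + \<tau>\<^sup>2))"
    proof (rule order_trans[OF norm_triangle_ineq4 add_mono])
      show "norm (K t) \<le> (LBINT \<tau>. C / (1 + \<tau>\<^sup>2))" unfolding K_def
        by (rule order_trans[OF integral_norm_bound integral_mono'])
          (use integrable_inverse_square b0 h0 CX in \<open>auto simp: norm_mult less_imp_le\<close>)
      show "norm (LBINT \<tau>. of_real (h2 \<tau>) * cis (t * \<tau>)) \<le> (LBINT \<tau>. (D\<^sup>2 + D) * C / (1 + \<tau>\<^sup>2))"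
        by (rule order_trans[OF integral_norm_bound integral_mono'])
          (use integrable_inverse_square b2h order_trans[OF abs_ge_zero b2h] in \<open>auto simp: norm_mult\<close>)
    qed
    also have "\<dots> = C'" unfolding C'_def
      by (subst Bochner_Integration.integral_add[symmetric])
         (auto intro!: integrable_inverse_square Bochner_Integration.integral_cong simp: algebra_simps add_divide_distrib)
    finally have "(1 + t\<^sup>2) * norm (K t) \<le> C'" unfolding norm_mult norm_of_real using pos[of t] by simp
    then show ?thesis by (simp only: pos_le_divide_eq[OF pos(1)] mult.commute)
  qed
  have [measurable]: "(\<lambda>(t,\<tau>). of_real (h \<tau>) * cis (t * \<tau>)) \<in> borel_measurable (lborel \<Otimes>\<^sub>M lborel)"
  proof -
    have "continuous_on UNIV (\<lambda>p::real\<times>real. complex_of_real (h (snd p)) * cis (fst p * snd p))"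
      by (intro continuous_intros continuous_on_compose2[OF ch(1)]) auto
    then have "(\<lambda>p::real\<times>real. complex_of_real (h (snd p)) * cis (fst p * snd p)) \<in> borel_measurable borel"
      by (rule borel_measurable_continuous_onI)
    then show ?thesis by (simp add: borel_prod case_prod_beta' measurable_lborel1 lborel_prod)
  qed
  have Km: "K \<in> borel_measurable lborel" unfolding K_def by measurable
  show "integrable lborel K"
    by (rule Bochner_Integration.integrable_bound[OF integrable_inverse_square[of C'] Km])
       (intro AE_I2 order_trans[OF Kb], simp only: real_norm_def abs_ge_self)
qed

section \<open>Gaussian test functions\<close>

lemma D1_eqI: "(f has_vector_derivative f') (at x) \<Longrightarrow> D1 f x = f'"
  by (simp add: D1_def vector_derivative_at)

lemma has_vector_derivative_D1: "f differentiable (at x) \<Longrightarrow> (f has_vector_derivative D1 f x) (at x)"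
  by (simp add: D1_def vector_derivative_works)

text \<open>On products of a function of time and a function of space the iterated partial derivatives separate, which
  reduces membership in the Schwartz space to one variable at a time.\<close>

lemma partial_product:
  assumes f: "\<And>j t. (D1 ^^ j) f differentiable (at t)" and p: "\<And>k x. (D1 ^^ k) p differentiable (at x)"
  shows "partial j k (\<lambda>t x. f t * p x) = (\<lambda>t x. (D1 ^^ j) f t * (D1 ^^ k) p x)"
proof -
  have "(partial_x ^^ k) (\<lambda>t x. f t * p x) = (\<lambda>t x. f t * (D1 ^^ k) p x)"
  proof (induction k)
    case (Suc k)
    have "D1 (\<lambda>x. f t * (D1 ^^ k) p x) x = f t * D1 ((D1 ^^ k) p) x" for t x
      by (intro D1_eqI has_vector_derivative_mult_right has_vector_derivative_D1 p)
    then show ?case unfolding funpow.simps o_apply Suc by (simp add: partial_x_def)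
  qed simp
  moreover have "(partial_t ^^ j) (\<lambda>t x. f t * (D1 ^^ k) p x) = (\<lambda>t x. (D1 ^^ j) f t * (D1 ^^ k) p x)"
  proof (induction j)
    case (Suc j)
    have "D1 (\<lambda>t. (D1 ^^ j) f t * (D1 ^^ k) p x) t = D1 ((D1 ^^ j) f) t * (D1 ^^ k) p x" for t x
      by (intro D1_eqI has_vector_derivative_mult_left has_vector_derivative_D1 f)
    then show ?case unfolding funpow.simps o_apply Suc by (simp add: partial_t_def)
  qed simp
  ultimately show ?thesis by (simp add: partial_def)
qed

lemma product_in_schwartz:
  assumes f: "\<And>j t. (D1 ^^ j) f differentiable (at t)" and p: "\<And>k x. (D1 ^^ k) p differentiable (at x)"
    and fb: "\<And>m j. \<exists>C. \<forall>t. (1 + \<bar>t\<bar>) ^ m * norm ((D1 ^^ j) f t) \<le> C"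
    and pb: "\<And>k. \<exists>C. \<forall>x. norm ((D1 ^^ k) p x) \<le> C" and per: "\<And>x. p (x + 2 * pi) = p x"
  shows "(\<lambda>t x. f t * p x) \<in> schwartz"
proof -
  note pp = partial_product[of f p, OF f p]
  have cf: "continuous_on UNIV ((D1 ^^ j) f)" for j
    using f by (intro differentiable_imp_continuous_on) (simp add: differentiable_on_def)
  have cp: "continuous_on UNIV ((D1 ^^ k) p)" for k
    using p by (intro differentiable_imp_continuous_on) (simp add: differentiable_on_def)
  have "continuous_on UNIV (\<lambda>(t, x). (D1 ^^ j) f t * (D1 ^^ k) p x)" for j k
    unfolding case_prod_beta'
    by (intro continuous_intros continuous_on_compose2[OF cf] continuous_on_compose2[OF cp]) auto
  moreover have "(\<lambda>r. (D1 ^^ j) f r * (D1 ^^ k) p x) differentiable (at t)"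
     "(\<lambda>x. (D1 ^^ j) f t * (D1 ^^ k) p x) differentiable (at x)" for j k t x
    using f p by (auto intro!: differentiable_mult)
  ultimately have "smooth2 (\<lambda>t x. f t * p x)" unfolding smooth2_def pp by auto
  moreover have "bdd_above (range (\<lambda>(t, x). (1 + \<bar>t\<bar>) ^ m * norm (partial j k (\<lambda>t x. f t * p x) t x)))" for m j k
  proof -
    obtain C where C: "\<And>t. (1 + \<bar>t\<bar>) ^ m * norm ((D1 ^^ j) f t) \<le> C" using fb by blast
    obtain D where D: "\<And>x. norm ((D1 ^^ k) p x) \<le> D" using pb by blast
    have "(1 + \<bar>t\<bar>) ^ m * norm ((D1 ^^ j) f t * (D1 ^^ k) p x) \<le> C * D" for t x
    proof -
      have "(1 + \<bar>t\<bar>) ^ m * norm ((D1 ^^ j) f t) * norm ((D1 ^^ k) p x) \<le> C * D"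
        using order_trans[OF _ C[of t]] by (intro mult_mono C D) auto
      then show ?thesis by (simp add: norm_mult mult.assoc)
    qed
    then show ?thesis unfolding pp by (intro bdd_aboveI[of _ "C * D"]) auto
  qed
  ultimately show ?thesis using per by (simp add: schwartz_def)
qed

text \<open>The functions \<open>q(t) exp (- a t\<^sup>2)\<close> with polynomial \<open>q\<close> are closed under differentiation; hence one decay
  estimate for this class covers all derivatives of a Gaussian.\<close>

lemma D1_gaussian_poly:
  "(D1 ^^ j) (\<lambda>t. of_real (poly q t * exp (- (a * t\<^sup>2)))) =
   (\<lambda>t. of_real (poly (((\<lambda>q. pderiv q - [:0, 2 * a:] * q) ^^ j) q) t * exp (- (a * t\<^sup>2))))"
proof (induction j)
  case (Suc j)
  have "((\<lambda>t. poly q t * exp (- (a * t\<^sup>2))) has_real_derivative poly (pderiv q - [:0, 2 * a:] * q) t * exp (- (a * t\<^sup>2))) (at t)" for q t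
    by (rule DERIV_cong[OF DERIV_mult[OF poly_DERIV DERIV_gaussian]]) (simp add: algebra_simps)
  then show ?case
    unfolding funpow.simps o_apply Suc by (intro ext D1_eqI has_vector_derivative_of_real)
qed simp

lemma poly_bound:
  fixes q :: "real poly"
  shows "\<exists>C M. C \<ge> 0 \<and> (\<forall>t. \<bar>poly q t\<bar> \<le> C * (1 + t\<^sup>2) ^ M)"
proof (induction q)
  case 0
  then show ?case by (intro exI[of _ 0]) simp
next
  case (pCons c q)
  then obtain C M where C: "C \<ge> 0" "\<And>t. \<bar>poly q t\<bar> \<le> C * (1 + t\<^sup>2) ^ M" by blast
  have "\<bar>poly (pCons c q) t\<bar> \<le> (\<bar>c\<bar> + C) * (1 + t\<^sup>2) ^ Suc M" for t
  proof -
    have "\<bar>c + t * poly q t\<bar> \<le> \<bar>c\<bar> * 1 + \<bar>t\<bar> * \<bar>poly q t\<bar>"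
      using abs_triangle_ineq[of c "t * poly q t"] by (simp add: abs_mult)
    also have "\<dots> \<le> \<bar>c\<bar> * (1 + t\<^sup>2) ^ Suc M + (1 + t\<^sup>2) * (C * (1 + t\<^sup>2) ^ M)"
      by (intro add_mono mult_mono C abs_le_one_plus_square one_le_power) auto
    also have "\<dots> = (\<bar>c\<bar> + C) * (1 + t\<^sup>2) ^ Suc M" by (simp add: algebra_simps)
    finally show ?thesis by simp
  qed
  then show ?case using C(1) by (intro exI[of _ "\<bar>c\<bar> + C"] exI[of _ "Suc M"]) auto
qed

lemma gaussian_poly_decay:
  assumes a: "a > 0"
  shows "\<exists>C. \<forall>t. (1 + \<bar>t\<bar>) ^ m * norm (complex_of_real (poly q t * exp (- (a * t\<^sup>2)))) \<le> C"
proof -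
  obtain C M where C: "C \<ge> 0" "\<And>t. \<bar>poly q t\<bar> \<le> C * (1 + t\<^sup>2) ^ M" using poly_bound by blast
  obtain D where D: "\<And>t. (1 + t\<^sup>2) ^ (m + M) * exp (- (a * t\<^sup>2)) \<le> D"
    using power_times_gaussian_bounded[OF a] by blast
  have "(1 + \<bar>t\<bar>) ^ m * norm (complex_of_real (poly q t * exp (- (a * t\<^sup>2)))) \<le> 2 ^ m * C * D" for t
  proof -
    have t: "1 + \<bar>t\<bar> \<le> 2 * (1 + t\<^sup>2)"
      using abs_le_one_plus_square[of t] zero_le_power2[of t] unfolding distrib_left by linarith
    have "(1 + \<bar>t\<bar>) ^ m * (\<bar>poly q t\<bar> * exp (- (a * t\<^sup>2))) \<le> (2 * (1 + t\<^sup>2)) ^ m * (C * (1 + t\<^sup>2) ^ M * exp (- (a * t\<^sup>2)))"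
      by (intro mult_mono power_mono t C) (auto intro!: C(1) mult_nonneg_nonneg)
    also have "\<dots> = 2 ^ m * C * ((1 + t\<^sup>2) ^ (m + M) * exp (- (a * t\<^sup>2)))"
      by (simp only: power_add power_mult_distrib mult_ac)
    also have "\<dots> \<le> 2 ^ m * C * D" using C(1) by (intro mult_left_mono D) auto
    finally show ?thesis by (simp add: abs_mult norm_mult del: of_real_mult)
  qed
  then show ?thesis by blast
qed

lemma D1_trig:
  assumes "finite S"
  shows "(D1 ^^ j) (\<lambda>x. \<Sum>k\<in>S. a k * cis (- (of_int k * x))) = (\<lambda>x. \<Sum>k\<in>S. (a k * (- \<i> * of_int k) ^ j) * cis (- (of_int k * x)))"
    and "(\<lambda>x. \<Sum>k\<in>S. a k * cis (- (of_int k * x))) differentiable (at x)"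
proof -
  have d: "((\<lambda>x. \<Sum>k\<in>S. a k * cis (- (of_int k * x))) has_vector_derivative (\<Sum>k\<in>S. (a k * (- \<i> * of_int k)) * cis (- (of_int k * x)))) (at x)" for a x
  proof (rule has_vector_derivative_eq_rhs[OF has_vector_derivative_sum])
    show "((\<lambda>x. a k * cis (- (of_int k * x))) has_vector_derivative a k * (of_real (- of_int k) * \<i> * cis (- (of_int k * x)))) (at x)" for k
      by (intro has_vector_derivative_mult_right cis_has_vector_derivative) (auto intro!: derivative_eq_intros)
  qed (simp add: mult_ac)
  show "(\<lambda>x. \<Sum>k\<in>S. a k * cis (- (of_int k * x))) differentiable (at x)"
    using d by (rule differentiableI_vector)
  show "(D1 ^^ j) (\<lambda>x. \<Sum>k\<in>S. a k * cis (- (of_int k * x))) = (\<lambda>x. \<Sum>k\<in>S. (a k * (- \<i> * of_int k) ^ j) * cis (- (of_int k * x)))"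
  proof (induction j)
    case (Suc j)
    show ?case
      unfolding funpow.simps o_apply Suc
      by (rule ext, rule trans[OF D1_eqI[OF d]]) (simp add: mult_ac)
  qed simp
qed

text \<open>Frequencies enter with a minus sign, because testing against \<open>e\<^bsup>- i k x\<^esup>\<close> reads off the \<open>k\<close>-th Fourier
  coefficient.\<close>

definition mode_test :: "int set \<Rightarrow> (int \<Rightarrow> real) \<Rightarrow> real \<Rightarrow> complex" where
  "mode_test S b x = (\<Sum>k\<in>S. of_real (b k) * cis (- (of_int k * x)))"

lemma mode_test_in_test_torus: "finite S \<Longrightarrow> mode_test S b \<in> test_torus"
  unfolding test_torus_def mode_test_def mem_Collect_eq D1_trig(1) cis_periodic
  by (simp add: D1_trig(2))

lemma gaussian_mode_test_in_schwartz:
  assumes "finite S" "\<delta> > 0"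
  shows "(\<lambda>t x. of_real (normal_density 0 \<delta> t) * mode_test S b x) \<in> schwartz"
proof -
  have a: "1 / (2 * \<delta>\<^sup>2) > 0" using assms by simp
  have n: "(\<lambda>t. complex_of_real (normal_density 0 \<delta> t)) =
      (\<lambda>t. of_real (poly [:1 / sqrt (2 * pi * \<delta>\<^sup>2):] t * exp (- (1 / (2 * \<delta>\<^sup>2) * t\<^sup>2))))"
    by (simp add: normal_density_def)
  show ?thesis
  proof (rule product_in_schwartz)
    show "(D1 ^^ j) (\<lambda>t. complex_of_real (normal_density 0 \<delta> t)) differentiable at t" for j t
      unfolding n D1_gaussian_poly
      by (rule differentiableI_vector[OF has_vector_derivative_of_real[OF DERIV_mult[OF poly_DERIV DERIV_gaussian]]])
    show "\<exists>C. \<forall>t. (1 + \<bar>t\<bar>) ^ m * norm ((D1 ^^ j) (\<lambda>t. complex_of_real (normal_density 0 \<delta> t)) t) \<le> C" for m j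
      unfolding n D1_gaussian_poly by (rule gaussian_poly_decay[OF a])
    show "(D1 ^^ k) (mode_test S b) differentiable at x" for k x
      using mode_test_in_test_torus[OF assms(1)] by (simp add: test_torus_def)
    show "mode_test S b (x + 2 * pi) = mode_test S b x" for x
      using mode_test_in_test_torus[OF assms(1)] by (simp add: test_torus_def)
    fix k
    have "norm ((D1 ^^ k) (mode_test S b) x) \<le> (\<Sum>n\<in>S. norm (of_real (b n) * (- \<i> * of_int n) ^ k))" for x
      unfolding mode_test_def D1_trig(1)[OF assms(1)]
      by (rule order_trans[OF norm_sum]) (simp add: norm_mult)
    then show "\<exists>C. \<forall>x. norm ((D1 ^^ k) (mode_test S b) x) \<le> C" by blast
  qed
qed

section \<open>Consequences of convergence\<close>

lemma distribution_mode_test: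
  assumes "distribution_torus \<Lambda>" "finite S"
  shows "\<Lambda> (\<lambda>x. c * mode_test S b x) = c * (\<Sum>k\<in>S. of_real (b k) * dist_coeff \<Lambda> k)"
proof -
  have add: "\<Lambda> (\<lambda>x. \<theta> x + \<eta> x) = \<Lambda> \<theta> + \<Lambda> \<eta>" if "\<theta> \<in> test_torus" "\<eta> \<in> test_torus" for \<theta> \<eta>
    using assms(1) that unfolding distribution_torus_def by blast
  have hom: "\<Lambda> (\<lambda>x. c * \<theta> x) = c * \<Lambda> \<theta>" if "\<theta> \<in> test_torus" for \<theta> c
    using assms(1) that unfolding distribution_torus_def by blast
  have cis: "(\<lambda>x. cis (- (of_int k * x))) = mode_test {k} (\<lambda>_. 1)" for k by (simp add: mode_test_def fun_eq_iff)
  have "\<Lambda> (mode_test S b) = (\<Sum>k\<in>S. of_real (b k) * dist_coeff \<Lambda> k)"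
    using assms(2)
  proof (induction S)
    case empty
    have "mode_test {} b = (\<lambda>x. 0 * mode_test {} b x)" by (simp add: mode_test_def fun_eq_iff)
    then have "\<Lambda> (mode_test {} b) = 0 * \<Lambda> (mode_test {} b)" using hom[OF mode_test_in_test_torus[of "{}" b], of 0] by simp
    then show ?case by simp
  next
    case (insert k S)
    have "mode_test (insert k S) b = (\<lambda>x. mode_test {k} b x + mode_test S b x)"
      using insert by (simp add: mode_test_def fun_eq_iff)
    then have "\<Lambda> (mode_test (insert k S) b) = \<Lambda> (mode_test {k} b) + \<Lambda> (mode_test S b)"
      using add[of "mode_test {k} b" "mode_test S b"] insert by (simp add: mode_test_in_test_torus)
    moreover have "mode_test {k} b = (\<lambda>x. of_real (b k) * mode_test {k} (\<lambda>_. 1) x)" by (simp add: mode_test_def fun_eq_iff)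
    then have "\<Lambda> (mode_test {k} b) = of_real (b k) * dist_coeff \<Lambda> k"
      using hom[OF mode_test_in_test_torus, of "{k}" "of_real (b k)" "\<lambda>_. 1"] by (simp add: dist_coeff_def cis)
    ultimately show ?case using insert by simp
  qed
  then show ?thesis using hom mode_test_in_test_torus[OF assms(2)] by simp
qed

text \<open>Cauchy--Schwarz, with the Sobolev weight moved to one factor and its inverse to the other.\<close>

lemma sobolev_duality:
  assumes "\<Lambda> \<in> sobolev_torus r" "finite S"
  shows "norm (\<Sum>k\<in>S. of_real (b k) * dist_coeff \<Lambda> k)
    \<le> sqrt (\<Sum>k\<in>S. (b k)\<^sup>2 * japanese (of_int k) powr (- (2 * r))) * sobolev_norm r (dist_coeff \<Lambda>)"
proof -
  define W where "W k = japanese (of_int k) powr r" for k :: int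
  have W: "W k > 0" for k
    unfolding W_def by (rule powr_gt_zero[THEN iffD2, OF less_imp_neq[OF japanese_pos, symmetric]])
  have "norm (\<Sum>k\<in>S. of_real (b k) * dist_coeff \<Lambda> k) \<le> (\<Sum>k\<in>S. (\<bar>b k\<bar> / W k) * (W k * norm (dist_coeff \<Lambda> k)))"
    using W by (intro order_trans[OF norm_sum]) (simp add: norm_mult less_imp_neq[THEN not_sym])
  also have "\<dots> \<le> sqrt ((\<Sum>k\<in>S. (\<bar>b k\<bar> / W k)\<^sup>2) * (\<Sum>k\<in>S. (W k * norm (dist_coeff \<Lambda> k))\<^sup>2))"
    by (rule real_le_rsqrt) (rule Cauchy_Schwarz_ineq_sum)
  also have "(\<Sum>k\<in>S. (\<bar>b k\<bar> / W k)\<^sup>2) = (\<Sum>k\<in>S. (b k)\<^sup>2 * japanese (of_int k) powr (- (2 * r)))"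
  proof (intro sum.cong refl)
    fix k
    have "(W k)\<^sup>2 = japanese (of_int k) powr (2 * r)"
      unfolding W_def power2_eq_square powr_add[symmetric] by simp
    then show "(\<bar>b k\<bar> / W k)\<^sup>2 = (b k)\<^sup>2 * japanese (of_int k) powr (- (2 * r))"
      by (simp add: powr_minus divide_inverse power_mult_distrib power_inverse)
  qed
  also have "sqrt ((\<Sum>k\<in>S. (b k)\<^sup>2 * japanese (of_int k) powr (- (2 * r))) * (\<Sum>k\<in>S. (W k * norm (dist_coeff \<Lambda> k))\<^sup>2))
     = sqrt (\<Sum>k\<in>S. (b k)\<^sup>2 * japanese (of_int k) powr (- (2 * r))) * sqrt (\<Sum>k\<in>S. (W k * norm (dist_coeff \<Lambda> k))\<^sup>2)"
    by (rule real_sqrt_mult)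
  also have "\<dots> \<le> sqrt (\<Sum>k\<in>S. (b k)\<^sup>2 * japanese (of_int k) powr (- (2 * r))) * sobolev_norm r (dist_coeff \<Lambda>)"
  proof (intro mult_left_mono)
    have "(\<Sum>k\<in>S. (norm (of_real (japanese (of_int k) powr r) * dist_coeff \<Lambda> k))\<^sup>2)
       \<le> (\<Sum>\<^sub>\<infinity>k. (norm (of_real (japanese (of_int k) powr r) * dist_coeff \<Lambda> k))\<^sup>2)"
      using assms by (intro finite_sum_le_infsum) (auto simp: sobolev_torus_def)
    then show "sqrt (\<Sum>k\<in>S. (W k * norm (dist_coeff \<Lambda> k))\<^sup>2) \<le> sobolev_norm r (dist_coeff \<Lambda>)"
      unfolding sobolev_norm_def using W by (simp add: norm_mult W_def)
  qed (simp add: sum_nonneg)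
  finally show ?thesis .
qed

text \<open>A Gaussian density has integral 1 for every width \<open>\<delta>\<close>, so the bound is uniform in \<open>\<delta>\<close>. This uniformity
  permits the passage to time zero.\<close>

lemma Linf_Sobolev_test_bound:
  assumes g: "g \<in> Linf_Sobolev r" and E: "esssup lborel (\<lambda>t. ereal (sobolev_norm r (dist_coeff (g t)))) < ereal E"
    and S: "finite S" and \<delta>: "\<delta> > 0"
  shows "norm (LBINT t. g t (\<lambda>x. of_real (normal_density 0 \<delta> t) * mode_test S b x))
    \<le> E * sqrt (\<Sum>k\<in>S. (b k)\<^sup>2 * japanese (of_int k) powr (- (2 * r)))"
proof -
  let ?Q = "sqrt (\<Sum>k\<in>S. (b k)\<^sup>2 * japanese (of_int k) powr (- (2 * r)))"
  have Q: "?Q \<ge> 0" by (simp add: sum_nonneg)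
  have gt: "g t \<in> sobolev_torus r" "distribution_torus (g t)" for t
    using g by (auto simp: Linf_Sobolev_def sobolev_torus_def)
  have "AE t in lborel. ereal (sobolev_norm r (dist_coeff (g t))) \<le> ereal E"
    using esssup_AE[of "\<lambda>t. ereal (sobolev_norm r (dist_coeff (g t)))" lborel]
  proof eventually_elim
    case (elim t)
    from le_less_trans[OF elim E] show ?case by simp
  qed
  then have ae: "AE t in lborel. norm (g t (\<lambda>x. of_real (normal_density 0 \<delta> t) * mode_test S b x)) \<le> normal_density 0 \<delta> t * (E * ?Q)"
  proof eventually_elim
    case (elim t)
    have "norm (g t (\<lambda>x. of_real (normal_density 0 \<delta> t) * mode_test S b x))
       = normal_density 0 \<delta> t * norm (\<Sum>k\<in>S. of_real (b k) * dist_coeff (g t) k)"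
      unfolding distribution_mode_test[OF gt(2) S] by (simp add: norm_mult)
    also have "\<dots> \<le> normal_density 0 \<delta> t * (?Q * sobolev_norm r (dist_coeff (g t)))"
      by (intro mult_left_mono sobolev_duality gt S) simp
    also have "\<dots> \<le> normal_density 0 \<delta> t * (?Q * E)"
      using elim by (intro mult_left_mono Q) auto
    finally show ?case by (simp add: mult.commute)
  qed
  then have "AE t in lborel. 0 \<le> normal_density 0 \<delta> t * (E * ?Q)"
    by eventually_elim (auto intro: order_trans[OF norm_ge_zero])
  then have "(LBINT t. norm (g t (\<lambda>x. of_real (normal_density 0 \<delta> t) * mode_test S b x))) \<le> (LBINT t. normal_density 0 \<delta> t * (E * ?Q))"
    using ae \<delta> by (intro integral_mono_AE') auto
  also have "\<dots> = E * ?Q" using \<delta> by simp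
  finally show ?thesis by (intro order_trans[OF integral_norm_bound])
qed

text \<open>Near the limit \<open>\<phi>\<close> the distributions are bounded: \<open>\<phi>\<close> is represented by a bounded function, and
  so is \<open>T N - \<phi>\<close>, with bound 1. The definition of \<open>Dt_pow\<close> by duality evaluates both
  at the same function \<open>Dt_test a \<psi>\<close>, and adding the two values gives that of \<open>T N\<close>.\<close>

lemma W_convergent_test_bound:
  assumes "W_convergent a r T"
  shows "\<exists>B N0. B \<ge> 0 \<and> (\<forall>N\<ge>N0. \<forall>S b \<delta>. finite S \<longrightarrow> \<delta> > 0 \<longrightarrow>
    norm (T N (Dt_test a (\<lambda>t x. of_real (normal_density 0 \<delta> t) * mode_test S b x)))
    \<le> B * sqrt (\<Sum>k\<in>S. (b k)\<^sup>2 * japanese (of_int k) powr (- (2 * r))))"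
proof -
  let ?Q = "\<lambda>S b. sqrt (\<Sum>k\<in>S. (b k)\<^sup>2 * japanese (of_int k) powr (- (2 * r)))"
  let ?\<psi> = "\<lambda>S b \<delta> t x. of_real (normal_density 0 \<delta> t) * mode_test S b x"
  obtain \<phi> where \<phi>: "\<phi> \<in> W_space a r" and lim: "(\<lambda>N. W_norm a r (\<lambda>\<psi>. T N \<psi> - \<phi> \<psi>)) \<longlonglongrightarrow> 0"
    using assms unfolding W_convergent_def by blast
  obtain g where g: "g \<in> Linf_Sobolev r" and rep: "represents g (Dt_pow a \<phi>)"
    using \<phi> unfolding W_space_def by blast
  have "esssup lborel (\<lambda>t. ereal (sobolev_norm r (dist_coeff (g t)))) < \<infinity>"
    using g unfolding Linf_Sobolev_def by blast
  then obtain E where E: "esssup lborel (\<lambda>t. ereal (sobolev_norm r (dist_coeff (g t)))) < ereal E"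
    using ereal_dense2 by blast
  have b\<phi>: "norm (\<phi> (Dt_test a (?\<psi> S b \<delta>))) \<le> E * ?Q S b" if "finite S" "\<delta> > 0" for S b \<delta>
    using Linf_Sobolev_test_bound[OF g E that, of b] rep gaussian_mode_test_in_schwartz[OF that, of b]
    unfolding represents_def Dt_pow_def by simp
  have "eventually (\<lambda>N. W_norm a r (\<lambda>\<psi>. T N \<psi> - \<phi> \<psi>) < 1) sequentially"
    using order_tendstoD(2)[OF lim, of 1] by simp
  then obtain N0 where N0: "\<And>N. N \<ge> N0 \<Longrightarrow> W_norm a r (\<lambda>\<psi>. T N \<psi> - \<phi> \<psi>) < 1"
    unfolding eventually_sequentially by blast
  have "norm (T N (Dt_test a (?\<psi> S b \<delta>))) \<le> (\<bar>E\<bar> + 1) * ?Q S b" if N: "N \<ge> N0" and S: "finite S" "\<delta> > 0" for N S b \<delta>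
  proof -
    obtain h where h: "h \<in> Linf_Sobolev r" and hrep: "represents h (Dt_pow a (\<lambda>\<psi>. T N \<psi> - \<phi> \<psi>))"
      and h1: "esssup lborel (\<lambda>t. ereal (sobolev_norm r (dist_coeff (h t)))) < ereal 1"
      using N0[OF N] unfolding W_norm_def INF_less_iff by (auto simp: one_ereal_def)
    have "norm (T N (Dt_test a (?\<psi> S b \<delta>)) - \<phi> (Dt_test a (?\<psi> S b \<delta>))) \<le> 1 * ?Q S b"
      using Linf_Sobolev_test_bound[OF h h1 S, of b] hrep gaussian_mode_test_in_schwartz[OF S, of b]
      unfolding represents_def Dt_pow_def by simp
    moreover have "E * ?Q S b \<le> \<bar>E\<bar> * ?Q S b" by (intro mult_right_mono) (auto simp: sum_nonneg)
    ultimately show ?thesis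
      using b\<phi>[OF S, of b] norm_triangle_sub[of "T N (Dt_test a (?\<psi> S b \<delta>))" "\<phi> (Dt_test a (?\<psi> S b \<delta>))"]
      unfolding distrib_right by linarith
  qed
  then show ?thesis by (intro exI[of _ "\<bar>E\<bar> + 1"] exI[of _ N0]) auto
qed

section \<open>The renormalized squares tested at time zero\<close>

lemma renormalized_square_trig:
  assumes "\<And>n. fourier_coeff u n = of_real (c n)"
  shows "renormalized_square \<alpha> \<sigma> u N t x =
    (\<Sum>(n,m)\<in>{-int N..int N}\<times>{-int N..int N}.
       (of_real (japanese (of_int n) powr \<sigma> * c n * (japanese (of_int m) powr \<sigma> * c m)) *
       cis (t * (\<bar>of_int n\<bar> powr \<alpha> - \<bar>of_int m\<bar> powr \<alpha>))) * cis (of_int (n - m) * x))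
    - of_real ((sobolev_norm \<sigma> (fourier_coeff (Pi_proj N u)))\<^sup>2)"
proof -
  let ?I = "{-int N..int N}"
  define d where "d n = japanese (of_int n) powr \<sigma> * c n" for n
  define e where "e n = cis (t * \<bar>of_int n\<bar> powr \<alpha>) * cis (of_int n * x)" for n :: int
  have "Dx_pow \<sigma> (propagator \<alpha> t (Pi_proj N u)) x = (\<Sum>n\<in>?I. of_real (d n) * e n)"
    unfolding Dx_pow_def propagator_def Pi_proj_def assms
    by (subst x_multiplier_trig, simp, subst x_multiplier_trig, simp) (simp add: d_def e_def mult_ac)
  moreover have "of_real ((norm z)\<^sup>2) = z * cnj z" for z
    using complex_norm_square by simp
  ultimately have "of_real ((norm (Dx_pow \<sigma> (propagator \<alpha> t (Pi_proj N u)) x))\<^sup>2) =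
     (\<Sum>n\<in>?I. \<Sum>m\<in>?I. of_real (d n) * e n * (of_real (d m) * cnj (e m)))"
    by (simp add: sum_product cnj_sum)
  also have "\<dots> = (\<Sum>n\<in>?I. \<Sum>m\<in>?I. (of_real (d n * d m) *
       cis (t * (\<bar>of_int n\<bar> powr \<alpha> - \<bar>of_int m\<bar> powr \<alpha>))) * cis (of_int (n - m) * x))"
    by (intro sum.cong refl) (simp add: e_def cis_cnj cis_mult algebra_simps)
  finally show ?thesis
    unfolding renormalized_square_def d_def by (simp add: sum.cartesian_product)
qed

lemma Dt_test_gaussian:
  assumes "\<delta> > 0"
  shows "Dt_test s (\<lambda>t x. of_real (normal_density 0 \<delta> t) * mode_test S b x) t x =
    mode_test S b x * (of_real (1 / (2 * pi)) * (LBINT \<tau>. of_real ((1 + \<tau>\<^sup>2) powr (s / 2) * exp (- (\<delta>\<^sup>2 / 2 * \<tau>\<^sup>2))) * cis (t * \<tau>)))"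
proof -
  have inner: "(LBINT r. of_real (normal_density 0 \<delta> r) * mode_test S b x * cis (- (r * \<tau>)))
      = mode_test S b x * of_real (exp (- (\<delta>\<^sup>2 / 2 * \<tau>\<^sup>2)))" for \<tau>
  proof -
    have "(LBINT r. of_real (normal_density 0 \<delta> r) * mode_test S b x * cis (- (r * \<tau>)))
       = (LBINT r. mode_test S b x * (of_real (normal_density 0 \<delta> r) * cis (r * (- \<tau>))))"
      by (simp add: mult_ac)
    also have "\<dots> = mode_test S b x * of_real (exp (- ((\<delta> * - \<tau>)\<^sup>2 / 2)))"
      unfolding integral_mult_right_zero normal_fourier[OF assms] ..
    finally show ?thesis by (simp add: power_mult_distrib)
  qed
  then have "Dt_test s (\<lambda>t x. of_real (normal_density 0 \<delta> t) * mode_test S b x) t x =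
     (1 / (2 * pi)) *\<^sub>R (LBINT \<tau>. mode_test S b x * (of_real ((1 + \<tau>\<^sup>2) powr (s / 2) * exp (- (\<delta>\<^sup>2 / 2 * \<tau>\<^sup>2))) * cis (t * \<tau>)))"
    unfolding Dt_test_def japanese_powr inner by (simp add: mult_ac)
  then show ?thesis
    unfolding integral_mult_right_zero by (simp add: scaleR_conv_of_real)
qed

text \<open>\<open>L\<close> is the multiplier applied to the Gaussian density of width \<open>\<delta>\<close>. Its transform at \<open>\<omega>\<close> is the symbol at
  \<open>- \<omega>\<close>, and the symbol is even.\<close>

lemma gaussian_multiplier_inversion:
  fixes s \<delta> \<omega> :: real
  assumes "\<delta> > 0"
  defines "L \<equiv> \<lambda>t. of_real (1 / (2 * pi)) * (LBINT \<tau>. of_real ((1 + \<tau>\<^sup>2) powr (s / 2) * exp (- (\<delta>\<^sup>2 / 2 * \<tau>\<^sup>2))) * cis (t * \<tau>))"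
  shows "integrable lborel (\<lambda>t. L t * cis (t * \<omega>))"
    and "(LBINT t. L t * cis (t * \<omega>)) = of_real (japanese \<omega> powr s * exp (- (\<delta>\<^sup>2 / 2 * \<omega>\<^sup>2)))"
proof -
  have a: "\<delta>\<^sup>2 / 2 > 0" using assms by simp
  note K = gaussian_multiplier_kernel_integrable[OF a, of "s / 2"]
  obtain B where B: "\<And>\<tau>. norm (complex_of_real ((1 + \<tau>\<^sup>2) powr (s / 2) * exp (- (\<delta>\<^sup>2 / 2 * \<tau>\<^sup>2)))) \<le> B"
    using K(3) by blast
  show "integrable lborel (\<lambda>t. L t * cis (t * \<omega>))"
    unfolding L_def by (intro integrable_cis_mult integrable_mult_right K(4))
  have "(LBINT t. L t * cis (t * \<omega>)) = of_real (1 / (2 * pi)) *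
      (LBINT t. (LBINT \<tau>. of_real ((1 + \<tau>\<^sup>2) powr (s / 2) * exp (- (\<delta>\<^sup>2 / 2 * \<tau>\<^sup>2))) * cis (t * \<tau>)) * cis (t * \<omega>))"
    unfolding L_def mult.assoc integral_mult_right_zero ..
  also have "\<dots> = of_real (1 / (2 * pi)) * (of_real (2 * pi) * of_real ((1 + (- \<omega>)\<^sup>2) powr (s / 2) * exp (- (\<delta>\<^sup>2 / 2 * (- \<omega>)\<^sup>2))))"
    unfolding fourier_inversion[OF K(1) K(2) B K(4)] ..
  finally show "(LBINT t. L t * cis (t * \<omega>)) = of_real (japanese \<omega> powr s * exp (- (\<delta>\<^sup>2 / 2 * \<omega>\<^sup>2)))"
    by (simp add: japanese_powr)
qed

text \<open>The value of the renormalized square, with the multiplier of order \<open>s\<close> in time applied, on the Gaussian test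
  function of width \<open>\<delta>\<close>. For \<open>\<delta> = 0\<close> the exponential is 1, and this is the sum of \<open>b k\<close> times the
  \<open>k\<close>-th Fourier coefficient at time zero.\<close>

definition pairing :: "real \<Rightarrow> real \<Rightarrow> real \<Rightarrow> real \<Rightarrow> int set \<Rightarrow> int set \<Rightarrow> (int \<Rightarrow> real) \<Rightarrow> (int \<Rightarrow> real) \<Rightarrow> real" where
  "pairing \<alpha> \<sigma> s \<delta> I S b c = (\<Sum>(n, m)\<in>I \<times> I. \<Sum>k\<in>S. if n - m = k then
     b k * (japanese (of_int n) powr \<sigma> * c n * (japanese (of_int m) powr \<sigma> * c m)) *
     (japanese (\<bar>of_int n\<bar> powr \<alpha> - \<bar>of_int m\<bar> powr \<alpha>) powr s *
       exp (- (\<delta>\<^sup>2 / 2 * (\<bar>of_int n\<bar> powr \<alpha> - \<bar>of_int m\<bar> powr \<alpha>)\<^sup>2))) else 0)"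

text \<open>The subtracted norm only affects the zero mode, and so disappears because \<open>0 \<notin> S\<close>.\<close>

lemma torus_integral_renormalized_square:
  assumes c: "\<And>n. fourier_coeff u n = of_real (c n)" and S: "finite S" "0 \<notin> S"
  shows "torus_integral (\<lambda>x. renormalized_square \<alpha> \<sigma> u N t x * (mode_test S b x * z)) =
    (\<Sum>(n, m)\<in>{-int N..int N} \<times> {-int N..int N}. \<Sum>k\<in>S. if n - m = k then
      of_real (b k * (japanese (of_int n) powr \<sigma> * c n * (japanese (of_int m) powr \<sigma> * c m))) *
      (z * cis (t * (\<bar>of_int n\<bar> powr \<alpha> - \<bar>of_int m\<bar> powr \<alpha>))) else 0)"
proof -
  let ?I = "{-int N..int N}"
  define P where "P = ?I \<times> ?I"
  have P: "finite P" by (simp add: P_def)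
  define A where "A p = of_real (japanese (of_int (fst p)) powr \<sigma> * c (fst p) * (japanese (of_int (snd p)) powr \<sigma> * c (snd p))) *
       cis (t * (\<bar>of_int (fst p)\<bar> powr \<alpha> - \<bar>of_int (snd p)\<bar> powr \<alpha>))" for p
  define Z where "Z = complex_of_real ((sobolev_norm \<sigma> (fourier_coeff (Pi_proj N u)))\<^sup>2)"
  have R: "renormalized_square \<alpha> \<sigma> u N t x = (\<Sum>p\<in>P. A p * cis (of_int (fst p - snd p) * x)) - Z" for x
    unfolding renormalized_square_trig[OF c] Z_def A_def P_def by (simp add: case_prod_beta')
  \<comment> \<open>The part from the square, as a trigonometric polynomial indexed by triples, and the part from the constant.\<close>
  define f1 where "f1 x = (\<Sum>q\<in>P\<times>S. (A (fst q) * of_real (b (snd q)) * z) * cis (of_int (fst (fst q) - snd (fst q) - snd q) * x))" for x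
  define f2 where "f2 x = (\<Sum>k\<in>S. (Z * of_real (b k) * z) * cis (of_int (- k) * x))" for x
  have "renormalized_square \<alpha> \<sigma> u N t x * (mode_test S b x * z) = f1 x - f2 x" for x
  proof -
    have "(\<Sum>p\<in>P. A p * cis (of_int (fst p - snd p) * x)) * (mode_test S b x * z) = f1 x"
    proof -
      have e: "cis (of_int (fst p - snd p - k) * x) = cis (of_int (fst p - snd p) * x) * cis (- (of_int k * x))" for p :: "int \<times> int" and k
        by (simp add: cis_mult left_diff_distrib)
      have "(\<Sum>p\<in>P. A p * cis (of_int (fst p - snd p) * x)) * (mode_test S b x * z)
        = (\<Sum>p\<in>P. \<Sum>k\<in>S. (A p * of_real (b k) * z) * cis (of_int (fst p - snd p - k) * x))"
        unfolding sum_distrib_right[of _ P]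
        by (intro sum.cong refl) (simp only: mode_test_def sum_distrib_right sum_distrib_left e, simp only: mult_ac)
      then show ?thesis unfolding f1_def by (simp add: sum.cartesian_product case_prod_beta')
    qed
    moreover have "Z * (mode_test S b x * z) = f2 x"
      unfolding f2_def mode_test_def sum_distrib_right sum_distrib_left by (intro sum.cong refl) simp
    ultimately show ?thesis unfolding R left_diff_distrib by simp
  qed
  then have "torus_integral (\<lambda>x. renormalized_square \<alpha> \<sigma> u N t x * (mode_test S b x * z)) = torus_integral (\<lambda>x. f1 x - f2 x)"
    by simp
  also have "\<dots> = torus_integral f1 - torus_integral f2"
  proof -
    have "set_integrable lborel {0..2*pi} f1" "set_integrable lborel {0..2*pi} f2"
      unfolding f1_def f2_def by (intro set_integrable_continuous_torus continuous_intros)+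
    then show ?thesis unfolding torus_integral_def by (simp add: set_integral_diff scaleR_diff_right)
  qed
  also have "torus_integral f2 = 0"
    unfolding f2_def using S by (subst torus_integral_trig) (auto intro!: sum.neutral)
  also have "torus_integral f1 = (\<Sum>q\<in>P\<times>S. if fst (fst q) - snd (fst q) - snd q = 0 then A (fst q) * of_real (b (snd q)) * z else 0)"
    unfolding f1_def using S P by (subst torus_integral_trig) auto
  also have "\<dots> = (\<Sum>p\<in>P. \<Sum>k\<in>S. if fst p - snd p - k = 0 then A p * of_real (b k) * z else 0)"
    by (simp add: sum.cartesian_product case_prod_beta')
  also have "\<dots> - 0 = (\<Sum>(n, m)\<in>?I \<times> ?I. \<Sum>k\<in>S. if n - m = k then
      of_real (b k * (japanese (of_int n) powr \<sigma> * c n * (japanese (of_int m) powr \<sigma> * c m))) *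
      (z * cis (t * (\<bar>of_int n\<bar> powr \<alpha> - \<bar>of_int m\<bar> powr \<alpha>))) else 0)"
    unfolding case_prod_beta' diff_0_right A_def P_def
    by (intro sum.cong refl if_cong) auto
  finally show ?thesis .
qed

lemma renormalized_square_pairing:
  assumes c: "\<And>n. fourier_coeff u n = of_real (c n)" and S: "finite S" "0 \<notin> S" and \<delta>: "\<delta> > 0"
  shows "dist_of_fun (renormalized_square \<alpha> \<sigma> u N) (Dt_test s (\<lambda>t x. of_real (normal_density 0 \<delta> t) * mode_test S b x))
    = of_real (pairing \<alpha> \<sigma> s \<delta> {-int N..int N} S b c)"
proof -
  let ?I = "{-int N..int N}"
  define L where "L t = of_real (1 / (2 * pi)) * (LBINT \<tau>. of_real ((1 + \<tau>\<^sup>2) powr (s / 2) * exp (- (\<delta>\<^sup>2 / 2 * \<tau>\<^sup>2))) * cis (t * \<tau>))" for t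
  note inv = gaussian_multiplier_inversion[OF \<delta>, of s, folded L_def]
  define q where "q n m k = complex_of_real (b k * (japanese (of_int n) powr \<sigma> * c n * (japanese (of_int m) powr \<sigma> * c m)))" for n m k
  have "dist_of_fun (renormalized_square \<alpha> \<sigma> u N) (Dt_test s (\<lambda>t x. of_real (normal_density 0 \<delta> t) * mode_test S b x))
     = (LBINT t. \<Sum>p\<in>?I \<times> ?I. \<Sum>k\<in>S. if fst p - snd p = k then
      q (fst p) (snd p) k * (L t * cis (t * (\<bar>of_int (fst p)\<bar> powr \<alpha> - \<bar>of_int (snd p)\<bar> powr \<alpha>))) else 0)"
    unfolding dist_of_fun_def Dt_test_gaussian[OF \<delta>] L_def[symmetric] torus_integral_renormalized_square[OF c S] q_def case_prod_beta' ..
  also have "\<dots> = (\<Sum>p\<in>?I \<times> ?I. \<Sum>k\<in>S. LBINT t. if fst p - snd p = k then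
      q (fst p) (snd p) k * (L t * cis (t * (\<bar>of_int (fst p)\<bar> powr \<alpha> - \<bar>of_int (snd p)\<bar> powr \<alpha>))) else 0)"
  proof -
    have i: "integrable lborel (\<lambda>t. if fst p - snd p = k then
      q (fst p) (snd p) k * (L t * cis (t * (\<bar>of_int (fst p)\<bar> powr \<alpha> - \<bar>of_int (snd p)\<bar> powr \<alpha>))) else 0)" for p k
      using inv(1) by (cases "fst p - snd p = k") simp_all
    show ?thesis
      by (subst Bochner_Integration.integral_sum, intro Bochner_Integration.integrable_sum i)
        (intro sum.cong refl Bochner_Integration.integral_sum i)
  qed
  also have "\<dots> = (\<Sum>p\<in>?I \<times> ?I. \<Sum>k\<in>S. if fst p - snd p = k then
      q (fst p) (snd p) k * of_real (japanese (\<bar>of_int (fst p)\<bar> powr \<alpha> - \<bar>of_int (snd p)\<bar> powr \<alpha>) powr s *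
       exp (- (\<delta>\<^sup>2 / 2 * (\<bar>of_int (fst p)\<bar> powr \<alpha> - \<bar>of_int (snd p)\<bar> powr \<alpha>)\<^sup>2))) else 0)"
    by (intro sum.cong refl) (simp add: inv(2) del: of_real_mult)
  also have "\<dots> = of_real (pairing \<alpha> \<sigma> s \<delta> ?I S b c)"
    unfolding pairing_def of_real_sum case_prod_beta' q_def by (intro sum.cong refl) simp
  finally show ?thesis .
qed

text \<open>The limit \<open>\<delta> \<rightarrow> 0\<close> in the bound on Gaussian test functions; all sums are finite, so it is
  taken termwise.\<close>

lemma W_convergent_pairing_bounded:
  assumes c: "\<And>n. fourier_coeff u n = of_real (c n)"
    and conv: "W_convergent s r (\<lambda>N. dist_of_fun (renormalized_square \<alpha> \<sigma> u N))"
  shows "\<exists>B N0. B \<ge> 0 \<and> (\<forall>N\<ge>N0. \<forall>S b. finite S \<longrightarrow> 0 \<notin> S \<longrightarrow>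
    pairing \<alpha> \<sigma> s 0 {-int N..int N} S b c \<le> B * sqrt (\<Sum>k\<in>S. (b k)\<^sup>2 * japanese (of_int k) powr (- (2 * r))))"
proof -
  obtain B N0 where B: "B \<ge> 0" and bd: "\<And>N S b \<delta>. \<lbrakk>N \<ge> N0; finite S; \<delta> > 0\<rbrakk> \<Longrightarrow>
    norm (dist_of_fun (renormalized_square \<alpha> \<sigma> u N) (Dt_test s (\<lambda>t x. of_real (normal_density 0 \<delta> t) * mode_test S b x)))
    \<le> B * sqrt (\<Sum>k\<in>S. (b k)\<^sup>2 * japanese (of_int k) powr (- (2 * r)))"
    using W_convergent_test_bound[OF conv] by blast
  have "pairing \<alpha> \<sigma> s 0 {-int N..int N} S b c \<le> B * sqrt (\<Sum>k\<in>S. (b k)\<^sup>2 * japanese (of_int k) powr (- (2 * r)))"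
    if N: "N \<ge> N0" and S: "finite S" "0 \<notin> S" for N S b
  proof (rule LIMSEQ_le_const2)
    have d: "(\<lambda>j. 1 / real (Suc j)) \<longlonglongrightarrow> 0" by (rule lim_1_over_n[THEN LIMSEQ_Suc])
    have cont: "continuous_on UNIV (\<lambda>\<delta>. pairing \<alpha> \<sigma> s \<delta> {-int N..int N} S b c)"
    proof -
      have "continuous_on UNIV (\<lambda>\<delta>::real. if P then f * (g * exp (- (\<delta>\<^sup>2 / 2 * y))) else 0)" for P and f g y :: real
        by (cases P) (auto intro!: continuous_intros)
      then show ?thesis
        unfolding pairing_def case_prod_beta' by (intro continuous_on_sum)
    qed
    show "(\<lambda>j. pairing \<alpha> \<sigma> s (1 / real (Suc j)) {-int N..int N} S b c) \<longlonglongrightarrow> pairing \<alpha> \<sigma> s 0 {-int N..int N} S b c"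
      by (rule continuous_on_tendsto_compose[OF cont d]) auto
    show "\<exists>M. \<forall>j\<ge>M. pairing \<alpha> \<sigma> s (1 / real (Suc j)) {-int N..int N} S b c \<le> B * sqrt (\<Sum>k\<in>S. (b k)\<^sup>2 * japanese (of_int k) powr (- (2 * r)))"
    proof (intro exI[of _ 0] allI impI)
      fix j :: nat
      have j: "1 / real (Suc j) > 0" by simp
      show "pairing \<alpha> \<sigma> s (1 / real (Suc j)) {-int N..int N} S b c \<le> B * sqrt (\<Sum>k\<in>S. (b k)\<^sup>2 * japanese (of_int k) powr (- (2 * r)))"
        using bd[OF N S(1) j, of b] unfolding renormalized_square_pairing[OF c S j] norm_of_real by linarith
    qed
  qed
  then show ?thesis using B by blast
qed

definition pairing_term :: "real \<Rightarrow> real \<Rightarrow> real \<Rightarrow> (int \<Rightarrow> real) \<Rightarrow> int \<Rightarrow> int \<Rightarrow> real" where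
  "pairing_term \<alpha> \<sigma> s c n m = (japanese (of_int n) powr \<sigma> * c n) * (japanese (of_int m) powr \<sigma> * c m) *
     japanese (\<bar>of_int n\<bar> powr \<alpha> - \<bar>of_int m\<bar> powr \<alpha>) powr s"

text \<open>Collecting the pairs by their difference exhibits the pairing as a sum over modes \<open>k\<close>.\<close>

lemma pairing_by_difference:
  assumes "finite I" "finite S"
  shows "pairing \<alpha> \<sigma> s 0 I S b c = (\<Sum>k\<in>S. \<Sum>m\<in>I. if m + k \<in> I then b k * pairing_term \<alpha> \<sigma> s c (m + k) m else 0)"
proof -
  have "pairing \<alpha> \<sigma> s 0 I S b c = (\<Sum>n\<in>I. \<Sum>m\<in>I. \<Sum>k\<in>S. if n = m + k then b k * pairing_term \<alpha> \<sigma> s c n m else 0)"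
    unfolding pairing_def sum.cartesian_product[symmetric] pairing_term_def by (intro sum.cong refl) auto
  also have "\<dots> = (\<Sum>k\<in>S. \<Sum>m\<in>I. \<Sum>n\<in>I. if n = m + k then b k * pairing_term \<alpha> \<sigma> s c n m else 0)"
    by (subst sum.swap, subst sum.swap[of _ S], subst sum.swap[of _ I S]) (intro sum.cong refl sum.swap)
  also have "\<dots> = (\<Sum>k\<in>S. \<Sum>m\<in>I. if m + k \<in> I then b k * pairing_term \<alpha> \<sigma> s c (m + k) m else 0)"
    using assms by (simp add: sum.delta')
  finally show ?thesis .
qed

lemma pairing_term_nonneg: "(\<And>n. c n \<ge> 0) \<Longrightarrow> pairing_term \<alpha> \<sigma> s c n m \<ge> 0"
  by (simp add: pairing_term_def)

text \<open>All terms are nonnegative, so a lower bound may keep any convenient set \<open>J k\<close> of pairs in each mode.\<close>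

lemma pairing_ge:
  assumes "finite I" "finite S" and b: "\<And>k. b k \<ge> 0" and c: "\<And>n. c n \<ge> 0"
    and J: "\<And>k m. k \<in> S \<Longrightarrow> m \<in> J k \<Longrightarrow> m \<in> I \<and> m + k \<in> I"
  shows "(\<Sum>k\<in>S. b k * (\<Sum>m\<in>J k. pairing_term \<alpha> \<sigma> s c (m + k) m)) \<le> pairing \<alpha> \<sigma> s 0 I S b c"
  unfolding pairing_by_difference[OF assms(1,2)]
proof (rule sum_mono)
  fix k assume k: "k \<in> S"
  have "b k * (\<Sum>m\<in>J k. pairing_term \<alpha> \<sigma> s c (m + k) m) = (\<Sum>m\<in>J k. if m + k \<in> I then b k * pairing_term \<alpha> \<sigma> s c (m + k) m else 0)"
    unfolding sum_distrib_left using J[OF k] by (intro sum.cong) auto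
  also have "\<dots> \<le> (\<Sum>m\<in>I. if m + k \<in> I then b k * pairing_term \<alpha> \<sigma> s c (m + k) m else 0)"
    using J[OF k] b c assms(1) by (intro sum_mono2) (auto intro!: mult_nonneg_nonneg pairing_term_nonneg)
  finally show "b k * (\<Sum>m\<in>J k. pairing_term \<alpha> \<sigma> s c (m + k) m) \<le> (\<Sum>m\<in>I. if m + k \<in> I then b k * pairing_term \<alpha> \<sigma> s c (m + k) m else 0)" .
qed

lemma pairing_term_mono:
  assumes "\<And>n. 0 \<le> c n" "\<And>n. c n \<le> c' n"
  shows "pairing_term \<alpha> \<sigma> s c n m \<le> pairing_term \<alpha> \<sigma> s c' n m"
  unfolding pairing_term_def using assms order_trans[OF assms]
  by (intro mult_right_mono mult_mono mult_left_mono) auto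

lemma pairing_term_scale: "pairing_term \<alpha> \<sigma> s (\<lambda>n. a * c n) n m = a\<^sup>2 * pairing_term \<alpha> \<sigma> s c n m"
  by (simp add: pairing_term_def power2_eq_square)

lemma pairing_mono:
  assumes "finite I'" "I \<subseteq> I'" "finite S" and b: "\<And>k. b k \<ge> 0" and c: "\<And>n. 0 \<le> c n" "\<And>n. c n \<le> c' n"
  shows "pairing \<alpha> \<sigma> s 0 I S b c \<le> pairing \<alpha> \<sigma> s 0 I' S b c'"
proof -
  have I: "finite I" using assms finite_subset by blast
  have c': "0 \<le> c' n" for n using order_trans[OF c] .
  have "(if m + k \<in> I then b k * pairing_term \<alpha> \<sigma> s c (m + k) m else 0) \<le> (if m + k \<in> I' then b k * pairing_term \<alpha> \<sigma> s c' (m + k) m else 0)" for m k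
    using assms(2) b pairing_term_mono[OF c] pairing_term_nonneg[of c', OF c'] by (auto intro!: mult_left_mono)
  then show ?thesis
    unfolding pairing_by_difference[OF I assms(3)] pairing_by_difference[OF assms(1,3)]
    using assms(1,2) b c' by (intro sum_mono order_trans[OF sum_mono sum_mono2]) (auto intro!: mult_nonneg_nonneg pairing_term_nonneg)
qed

lemma pairing_scale:
  assumes "finite I" "finite S"
  shows "pairing \<alpha> \<sigma> s 0 I S b (\<lambda>n. a * c n) = a\<^sup>2 * pairing \<alpha> \<sigma> s 0 I S b c"
  unfolding pairing_by_difference[OF assms] pairing_term_scale sum_distrib_left
  by (intro sum.cong refl) auto

section \<open>Blocks of frequencies with a large pairing\<close>

text \<open>The mean value theorem: up to \<open>y\<close>, the dispersion separates two modes by at most their distance times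
  \<open>y\<close> to the power \<open>\<alpha> - 1\<close>, up to a constant.\<close>

lemma powr_diff_le:
  fixes x y :: real
  assumes "0 < x" "x < y" "\<alpha> > 1"
  shows "\<bar>y powr \<alpha> - x powr \<alpha>\<bar> \<le> \<alpha> * y powr (\<alpha> - 1) * (y - x)"
proof -
  have "\<exists>z. z > x \<and> z < y \<and> y powr \<alpha> - x powr \<alpha> = (y - x) * (\<alpha> * z powr (\<alpha> - 1))"
    using assms by (intro MVT2) (auto intro!: has_real_derivative_powr)
  then obtain z where z: "z > x" "z < y" "y powr \<alpha> - x powr \<alpha> = (y - x) * (\<alpha> * z powr (\<alpha> - 1))" by blast
  have "z powr (\<alpha> - 1) \<le> y powr (\<alpha> - 1)" using z assms by (intro powr_mono2) auto
  then have "(y - x) * (\<alpha> * z powr (\<alpha> - 1)) \<le> (y - x) * (\<alpha> * y powr (\<alpha> - 1))"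
    using assms by (intro mult_left_mono) auto
  moreover have "x powr \<alpha> \<le> y powr \<alpha>" using assms by (intro powr_mono2) auto
  ultimately show ?thesis using z(3) by (simp add: mult_ac)
qed

text \<open>For two frequencies of size comparable to \<open>R\<close>, the weights in space contribute \<open>R\<close> to the power \<open>2\<sigma>\<close>, and the
  time multiplier, whose argument is at most of order \<open>(n - m)\<close> times \<open>R\<close> to the power \<open>\<alpha> - 1\<close>, loses the \<open>s\<close>-th power
  of that. This determines the critical exponent \<open>s = 2\<sigma> / (\<alpha> - 1)\<close>.\<close>

lemma pairing_term_ge:
  fixes n m :: int and R :: real
  assumes "\<alpha> > 1" "\<sigma> > 0" "s \<ge> 0" and c: "\<And>n. c n \<ge> 0" and R: "R \<ge> 1" "R \<le> m" "m < n" "of_int n \<le> 4 * R"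
  shows "c n * c m * ((1 + \<alpha> * 4 powr (\<alpha> - 1)) powr (- s) * of_int (n - m) powr (- s) * R powr (2 * \<sigma> - (\<alpha> - 1) * s))
    \<le> pairing_term \<alpha> \<sigma> (- s) c n m"
proof -
  have mn: "0 < real_of_int m" "real_of_int m < of_int n" "1 \<le> real_of_int (n - m)" using R by linarith+
  have "\<bar>\<bar>of_int n\<bar> powr \<alpha> - \<bar>of_int m\<bar> powr \<alpha>\<bar> \<le> \<alpha> * of_int n powr (\<alpha> - 1) * (of_int n - of_int m)"
    using powr_diff_le[OF mn(1,2) assms(1)] mn by simp
  also have "\<dots> \<le> \<alpha> * (4 * R) powr (\<alpha> - 1) * of_int (n - m)"
    using assms mn by (simp, intro mult_right_mono mult_left_mono powr_mono2) auto
  also have "\<dots> = \<alpha> * 4 powr (\<alpha> - 1) * (R powr (\<alpha> - 1) * of_int (n - m))"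
    using R by (simp add: powr_mult)
  finally have d: "\<bar>\<bar>of_int n\<bar> powr \<alpha> - \<bar>of_int m\<bar> powr \<alpha>\<bar> \<le> \<alpha> * 4 powr (\<alpha> - 1) * (R powr (\<alpha> - 1) * of_int (n - m))" .
  have "1 \<le> R powr (\<alpha> - 1)" using R assms by (intro ge_one_powr_ge_zero) auto
  then have "1 * 1 \<le> R powr (\<alpha> - 1) * of_int (n - m)" using mn(3) by (intro mult_mono) auto
  then have jl: "japanese (\<bar>of_int n\<bar> powr \<alpha> - \<bar>of_int m\<bar> powr \<alpha>) \<le> (1 + \<alpha> * 4 powr (\<alpha> - 1)) * (R powr (\<alpha> - 1) * of_int (n - m))"
    using order_trans[OF japanese_le add_left_mono[OF d]] unfolding distrib_right by linarith
  have "(1 + \<alpha> * 4 powr (\<alpha> - 1)) powr (- s) * of_int (n - m) powr (- s) * R powr (2 * \<sigma> - (\<alpha> - 1) * s)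
     = R powr \<sigma> * R powr \<sigma> * ((1 + \<alpha> * 4 powr (\<alpha> - 1)) * (R powr (\<alpha> - 1) * of_int (n - m))) powr (- s)"
  proof -
    have "0 \<le> 1 + \<alpha> * 4 powr (\<alpha> - 1)" using assms by (intro add_nonneg_nonneg) auto
    then have "((1 + \<alpha> * 4 powr (\<alpha> - 1)) * (R powr (\<alpha> - 1) * of_int (n - m))) powr (- s)
       = (1 + \<alpha> * 4 powr (\<alpha> - 1)) powr (- s) * (R powr ((\<alpha> - 1) * - s) * of_int (n - m) powr (- s))"
      using mn R by (simp only: powr_mult powr_powr)
    moreover have "R powr (2 * \<sigma> - (\<alpha> - 1) * s) = R powr \<sigma> * R powr \<sigma> * R powr ((\<alpha> - 1) * - s)"
      by (simp add: powr_add[symmetric])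
    ultimately show ?thesis by (simp only: mult_ac)
  qed
  also have "\<dots> \<le> japanese (of_int n) powr \<sigma> * japanese (of_int m) powr \<sigma> * japanese (\<bar>of_int n\<bar> powr \<alpha> - \<bar>of_int m\<bar> powr \<alpha>) powr (- s)"
  proof -
    have "R \<le> japanese (of_int n)" "R \<le> japanese (of_int m)"
      using japanese_ge(2)[of "of_int n"] japanese_ge(2)[of "of_int m"] R by linarith+
    then have "R powr \<sigma> \<le> japanese (of_int n) powr \<sigma>" "R powr \<sigma> \<le> japanese (of_int m) powr \<sigma>"
      using assms(2) R(1) by (auto intro!: powr_mono2)
    moreover have "((1 + \<alpha> * 4 powr (\<alpha> - 1)) * (R powr (\<alpha> - 1) * of_int (n - m))) powr (- s)
      \<le> japanese (\<bar>of_int n\<bar> powr \<alpha> - \<bar>of_int m\<bar> powr \<alpha>) powr (- s)"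
      using assms(3) by (intro powr_mono2' jl japanese_pos) auto
    ultimately show ?thesis by (intro mult_mono) auto
  qed
  finally have "c n * c m * ((1 + \<alpha> * 4 powr (\<alpha> - 1)) powr (- s) * of_int (n - m) powr (- s) * R powr (2 * \<sigma> - (\<alpha> - 1) * s))
     \<le> c n * c m * (japanese (of_int n) powr \<sigma> * japanese (of_int m) powr \<sigma> * japanese (\<bar>of_int n\<bar> powr \<alpha> - \<bar>of_int m\<bar> powr \<alpha>) powr (- s))"
    using c by (intro mult_left_mono) auto
  then show ?thesis by (simp add: pairing_term_def mult_ac)
qed

text \<open>A block \<open>w\<close> of norm at most 1 in \<open>L\<^sup>2\<close> whose square, tested by weights \<open>b\<close> in the unit ball of the
  space dual to the Sobolev space of order \<open>- s2\<close>, gives at least \<open>C\<close>.\<close>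

definition large_block :: "real \<Rightarrow> real \<Rightarrow> real \<Rightarrow> real \<Rightarrow> real \<Rightarrow> nat \<Rightarrow> int set \<Rightarrow> (int \<Rightarrow> real) \<Rightarrow> (int \<Rightarrow> real) \<Rightarrow> bool" where
  "large_block \<alpha> \<sigma> s1 s2 C N S b w \<longleftrightarrow> finite S \<and> 0 \<notin> S \<and> (\<forall>k. 0 \<le> b k) \<and> (\<forall>n. 0 \<le> w n) \<and> (\<forall>n. n \<notin> {-int N..int N} \<longrightarrow> w n = 0) \<and>
     (\<Sum>n\<in>{-int N..int N}. (w n)\<^sup>2) \<le> 1 \<and> (\<Sum>k\<in>S. (b k)\<^sup>2 * japanese (of_int k) powr (2 * s2)) \<le> 1 \<and>
     C \<le> pairing \<alpha> \<sigma> (- s1) 0 {-int N..int N} S b w"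

lemma powr_unbounded:
  assumes "p > 0" "c > 0"
  shows "\<exists>n::nat. n \<ge> 1 \<and> C \<le> c * real n powr p"
proof -
  have "filterlim (\<lambda>n. c * real n powr p) at_top at_top" using assms by real_asymp
  then have "eventually (\<lambda>n. C \<le> c * real n powr p) at_top" by (simp add: filterlim_at_top)
  then have "eventually (\<lambda>n. n \<ge> 1 \<and> C \<le> c * real n powr p) at_top"
    using eventually_ge_at_top[of 1] by eventually_elim auto
  then show ?thesis by (rule eventually_happens'[OF sequentially_bot])
qed

lemma normalized_mode: "(japanese y powr (- r))\<^sup>2 * japanese y powr (2 * r) = 1"
proof -
  have "japanese y \<noteq> 0" using japanese_ge(1)[of y] by linarith
  then show ?thesis by (simp add: power2_eq_square powr_add[symmetric])
qed

lemma sum_two_points: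
  assumes "a \<noteq> b" "a \<in> I" "b \<in> I" "finite I"
  shows "(\<Sum>n\<in>I. (if n \<in> {a, b} then 1 / sqrt 2 else 0)\<^sup>2) = (1::real)"
proof -
  have "(\<Sum>n\<in>I. (if n \<in> {a, b} then 1 / sqrt 2 else 0)\<^sup>2) = (\<Sum>n\<in>{a, b}. 1 / 2 :: real)"
    using assms by (intro sum.mono_neutral_cong_right) (auto simp: power_divide)
  then show ?thesis using assms by simp
qed

text \<open>The weight makes the single mode \<open>k\<close> a unit vector of the dual space.\<close>

lemma two_point_block:
  assumes n: "m \<in> {-int N..int N}" "m + k \<in> {-int N..int N}" "k \<noteq> 0"
    and C: "C \<le> japanese (of_int k) powr (- s2) * pairing_term \<alpha> \<sigma> (- s1) (\<lambda>n. if n \<in> {m, m + k} then 1 / sqrt 2 else 0) (m + k) m"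
  shows "large_block \<alpha> \<sigma> s1 s2 C N {k} (\<lambda>_. japanese (of_int k) powr (- s2)) (\<lambda>n. if n \<in> {m, m + k} then 1 / sqrt 2 else 0)"
proof -
  have "C \<le> pairing \<alpha> \<sigma> (- s1) 0 {-int N..int N} {k} (\<lambda>_. japanese (of_int k) powr (- s2)) (\<lambda>n. if n \<in> {m, m + k} then 1 / sqrt 2 else 0)"
    using n by (intro order_trans[OF _ pairing_ge[where J="\<lambda>_. {m}"]]) (use C in auto)
  moreover have "(\<Sum>n\<in>{-int N..int N}. (if n \<in> {m, m + k} then 1 / sqrt 2 else 0)\<^sup>2) = (1::real)"
    using n by (intro sum_two_points) auto
  ultimately show ?thesis unfolding large_block_def using n normalized_mode by auto
qed

text \<open>The mode \<open>k = 1\<close> stays fixed while \<open>n\<close> grows, so its weight in space is a constant factor, and the pairing grows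
  like \<open>n\<close> to a positive power.\<close>

lemma large_block_neighbouring_modes:
  assumes \<alpha>: "\<alpha> > 1" and \<sigma>: "\<sigma> > 0" and s1: "s1 < 2 * \<sigma> / (\<alpha> - 1)"
  shows "\<exists>N S b w. large_block \<alpha> \<sigma> s1 s2 C N S b w"
proof -
  \<comment> \<open>For negative \<open>s1\<close> the time weight is at least 1, and the estimate with exponent 0 is already enough.\<close>
  define s where "s = max s1 0"
  have s: "s \<ge> 0" "s1 \<le> s" "2 * \<sigma> - (\<alpha> - 1) * s > 0"
    using assms by (auto simp: s_def field_simps max_def)
  define c where "c = japanese (of_int 1) powr (- s2) * (1 / 2 * ((1 + \<alpha> * 4 powr (\<alpha> - 1)) powr (- s)))"
  have "japanese 1 > 0" "1 + \<alpha> * 4 powr (\<alpha> - 1) > 0"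
    using japanese_ge(1)[of 1] \<alpha> by (auto intro: add_pos_nonneg)
  then have "c > 0" by (simp add: c_def)
  then obtain n :: nat where n: "n \<ge> 1" "C \<le> c * real n powr (2 * \<sigma> - (\<alpha> - 1) * s)"
    using powr_unbounded[OF s(3)] by blast
  let ?w = "\<lambda>i::int. if i \<in> {int n, int n + 1} then 1 / sqrt 2 else (0::real)"
  note n(2)
  also have "c * real n powr (2 * \<sigma> - (\<alpha> - 1) * s) \<le> japanese (of_int 1) powr (- s2) * pairing_term \<alpha> \<sigma> (- s) ?w (int n + 1) (int n)"
    using pairing_term_ge[OF \<alpha> \<sigma> s(1), of ?w "real n" "int n" "int n + 1"] n(1)
    unfolding c_def mult.assoc by (intro mult_left_mono) (auto simp: mult_ac)
  also have "\<dots> \<le> japanese (of_int 1) powr (- s2) * pairing_term \<alpha> \<sigma> (- s1) ?w (int n + 1) (int n)"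
    unfolding pairing_term_def using s japanese_ge(1) by (intro mult_left_mono powr_mono) auto
  finally show ?thesis
    using two_point_block[of "int n" "n + 1" 1] by fastforce
qed

text \<open>The frequencies \<open>n\<close> and \<open>- n\<close> oscillate identically in time, so the time multiplier is 1 on this
  term, and the weight of the mode \<open>k = 2n\<close> in space decides about the growth.\<close>

lemma large_block_opposite_modes:
  assumes \<sigma>: "\<sigma> > 0" and s2: "s2 < 2 * \<sigma>"
  shows "\<exists>N S b w. large_block \<alpha> \<sigma> s1 s2 C N S b w"
proof -
  define s where "s = max s2 0"
  have s: "s \<ge> 0" "s2 \<le> s" "2 * \<sigma> - s > 0" using assms by (auto simp: s_def)
  obtain n :: nat where n: "n \<ge> 1" "C \<le> (3 powr (- s) / 2) * real n powr (2 * \<sigma> - s)"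
    using powr_unbounded[OF s(3), of "3 powr (- s) / 2"] by auto
  let ?w = "\<lambda>i::int. if i \<in> {- int n, - int n + 2 * int n} then 1 / sqrt 2 else (0::real)"
  note n(2)
  also have "(3 powr (- s) / 2) * real n powr (2 * \<sigma> - s) = (3 * real n) powr (- s) * (1 / 2 * (real n powr \<sigma> * real n powr \<sigma>))"
  proof -
    have "real n powr (2 * \<sigma> - s) = real n powr \<sigma> * real n powr \<sigma> * real n powr (- s)"
      by (simp add: powr_add[symmetric])
    then show ?thesis by (simp add: powr_mult)
  qed
  also have "\<dots> \<le> japanese (of_int (2 * int n)) powr (- s) * (1 / 2 * (japanese (of_int n) powr \<sigma> * japanese (of_int n) powr \<sigma>))"
  proof -
    have "japanese (of_int (2 * int n)) \<le> 3 * real n"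
      using japanese_le[of "of_int (2 * int n)"] n(1) by simp
    then have "(3 * real n) powr (- s) \<le> japanese (of_int (2 * int n)) powr (- s)"
      using s(1) by (intro powr_mono2' japanese_pos) auto
    moreover have "real n powr \<sigma> \<le> japanese (of_int n) powr \<sigma>"
      using japanese_ge(2)[of "real n"] \<sigma> by (intro powr_mono2) auto
    ultimately show ?thesis by (intro mult_mono mult_left_mono) auto
  qed
  also have "\<dots> \<le> japanese (of_int (2 * int n)) powr (- s2) * (1 / 2 * (japanese (of_int n) powr \<sigma> * japanese (of_int n) powr \<sigma>))"
    using s japanese_ge(1) by (intro mult_right_mono powr_mono) auto
  also have "\<dots> = japanese (of_int (2 * int n)) powr (- s2) * pairing_term \<alpha> \<sigma> (- s1) ?w (- int n + 2 * int n) (- int n)"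
    by (simp add: pairing_term_def japanese_def)
  finally show ?thesis
    using two_point_block[of "- int n" n "2 * int n"] n(1) by fastforce
qed

text \<open>At \<open>s2 = 1/2 - s1\<close> the weighted contribution of two frequencies need not grow, hence many pairs have to be
  added up in many modes. With \<open>w\<close> constant on \<open>{2L..4L}\<close>, every mode \<open>k \<le> L\<close>
  receives about \<open>L\<close> pairs. Each pair contributes at least of order \<open>k\<close> to the power \<open>- s1\<close>,
  divided by \<open>L\<close>, because the powers of \<open>L\<close> from the weights cancel at the critical exponent. The extremal weights \<open>b k\<close> for
  \<open>s2 = 1/2 - s1\<close> are proportional to \<open>k\<close> to the power \<open>s1 - 1\<close>. With these, up to constants, the pairing is at
  least the harmonic sum \<open>H\<close> and the square of the norm of \<open>b\<close> at most \<open>H\<close>, so after normalization the pairing is at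
  least the square root of \<open>H\<close>, which is unbounded.\<close>

lemma large_block_critical_exponents:
  assumes \<alpha>: "\<alpha> > 1" and \<sigma>: "\<sigma> > 0" and s1: "s1 = 2 * \<sigma> / (\<alpha> - 1)" and s2: "s2 \<le> 1 / 2 - s1"
  shows "\<exists>N S b w. large_block \<alpha> \<sigma> s1 s2 C N S b w"
proof -
  have s: "s1 > 0" "2 * \<sigma> - (\<alpha> - 1) * s1 = 0" using assms by auto
  define A where "A = (1 + \<alpha> * 4 powr (\<alpha> - 1)) powr (- s1)"
  define D where "D = 2 powr \<bar>1 - 2 * s1\<bar>"
  have "1 + \<alpha> * 4 powr (\<alpha> - 1) > 0" using \<alpha> by (intro add_pos_nonneg) auto
  then have A: "A > 0" by (simp add: A_def)
  have D: "D > 0" by (simp add: D_def)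
  have "filterlim (\<lambda>n. A / (2 * sqrt D) * sqrt (harm n)) at_top sequentially"
    using A D by (intro filterlim_tendsto_pos_mult_at_top[OF tendsto_const] filterlim_compose[OF sqrt_at_top] harm_at_top) auto
  then have "eventually (\<lambda>n. C \<le> A / (2 * sqrt D) * sqrt (harm n)) sequentially" by (simp add: filterlim_at_top)
  then have "eventually (\<lambda>n. n \<ge> 1 \<and> C \<le> A / (2 * sqrt D) * sqrt (harm n)) sequentially"
    using eventually_ge_at_top[of 1] by eventually_elim auto
  then obtain L :: nat where L: "L \<ge> 1" "C \<le> A / (2 * sqrt D) * sqrt (harm L)"
    using eventually_happens'[OF sequentially_bot] by blast
  define H :: real where "H = harm L"
  have H: "H > 0" using L(1) by (simp add: H_def harm_pos)
  \<comment> \<open>The constant that normalizes \<open>b\<close>; \<open>D\<close> is the cost of replacing \<open>\<langle>k\<rangle>\<close> by \<open>k\<close> in the weights.\<close>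
  define \<beta> where "\<beta> = 1 / sqrt (D * H)"
  have \<beta>: "\<beta> > 0" "\<beta>\<^sup>2 = 1 / (D * H)" using D H by (auto simp: \<beta>_def power_divide)
  define b where "b k = \<beta> * real_of_int k powr (s1 - 1)" for k
  define w where "w n = (if n \<in> {2 * int L..4 * int L} then 1 / sqrt (2 * real L + 1) else 0)" for n
  define S where "S = int ` {1..L}"
  have S: "finite S" "0 \<notin> S" "\<And>k. k \<in> S \<Longrightarrow> 1 \<le> k \<and> k \<le> int L" by (auto simp: S_def)
  have sumH: "(\<Sum>k\<in>S. 1 / real_of_int k) = H"
    unfolding S_def H_def harm_def by (subst sum.reindex) (auto simp: inverse_eq_divide)
  have w2: "(\<Sum>n\<in>{-int (4 * L)..int (4 * L)}. (w n)\<^sup>2) \<le> 1"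
  proof -
    have "(\<Sum>n\<in>{-int (4 * L)..int (4 * L)}. (w n)\<^sup>2) = (\<Sum>n\<in>{2 * int L..4 * int L}. 1 / (2 * real L + 1))"
      by (intro sum.mono_neutral_cong_right) (auto simp: w_def power_divide)
    also have "\<dots> = 1" by (simp add: field_simps)
    finally show ?thesis by simp
  qed
  have b2: "(\<Sum>k\<in>S. (b k)\<^sup>2 * japanese (of_int k) powr (2 * s2)) \<le> 1"
  proof -
    have "(b k)\<^sup>2 * japanese (of_int k) powr (2 * s2) \<le> \<beta>\<^sup>2 * D * (1 / of_int k)" if k: "k \<in> S" for k
    proof -
      have k1: "real_of_int k \<ge> 1" using S(3)[OF k] by simp
      have jk: "of_int k \<le> japanese (of_int k)" "japanese (of_int k) \<le> 2 * of_int k"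
        using japanese_ge(2)[of "of_int k"] japanese_le[of "of_int k"] k1 by auto
      have "japanese (of_int k) powr (2 * s2) \<le> japanese (of_int k) powr (1 - 2 * s1)"
        using s2 japanese_ge(1) by (intro powr_mono) auto
      also have "\<dots> \<le> D * of_int k powr (1 - 2 * s1)"
      proof (cases "1 - 2 * s1 \<ge> 0")
        case True
        then have "japanese (of_int k) powr (1 - 2 * s1) \<le> (2 * of_int k) powr (1 - 2 * s1)"
          using jk k1 by (intro powr_mono2) auto
        then show ?thesis using True k1 by (simp add: powr_mult D_def)
      next
        case False
        then have "japanese (of_int k) powr (1 - 2 * s1) \<le> of_int k powr (1 - 2 * s1)"
          using jk k1 by (intro powr_mono2') auto
        also have "\<dots> \<le> D * of_int k powr (1 - 2 * s1)"
          unfolding D_def using ge_one_powr_ge_zero[of 2 "\<bar>1 - 2 * s1\<bar>"] by (simp add: mult_le_cancel_right1)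
        finally show ?thesis .
      qed
      finally have "(b k)\<^sup>2 * japanese (of_int k) powr (2 * s2) \<le> (b k)\<^sup>2 * (D * of_int k powr (1 - 2 * s1))"
        by (intro mult_left_mono) auto
      also have "\<dots> = \<beta>\<^sup>2 * D * (of_int k powr (s1 - 1) * of_int k powr (s1 - 1) * of_int k powr (1 - 2 * s1))"
        by (simp add: b_def power2_eq_square mult_ac)
      also have "of_int k powr (s1 - 1) * of_int k powr (s1 - 1) * of_int k powr (1 - 2 * s1) = 1 / real_of_int k"
        using k1 by (simp add: powr_add[symmetric] powr_minus_divide)
      finally show ?thesis .
    qed
    then have "(\<Sum>k\<in>S. (b k)\<^sup>2 * japanese (of_int k) powr (2 * s2)) \<le> (\<Sum>k\<in>S. \<beta>\<^sup>2 * D * (1 / of_int k))"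
      by (rule sum_mono)
    also have "\<dots> = \<beta>\<^sup>2 * D * H" unfolding sum_distrib_left[symmetric] sumH ..
    also have "\<dots> = 1" using \<beta>(2) D H by simp
    finally show ?thesis .
  qed
  have w0: "w n \<ge> 0" for n by (simp add: w_def)
  have b0: "b k \<ge> 0" for k using \<beta> by (simp add: b_def)
  have "C \<le> pairing \<alpha> \<sigma> (- s1) 0 {-int (4 * L)..int (4 * L)} S b w"
  proof -
    have inner: "A / 2 * of_int k powr (- s1) \<le> (\<Sum>m\<in>{2 * int L..3 * int L}. pairing_term \<alpha> \<sigma> (- s1) w (m + k) m)" if k: "k \<in> S" for k
    proof -
      have t: "1 / (2 * real L + 1) * (A * of_int k powr (- s1)) \<le> pairing_term \<alpha> \<sigma> (- s1) w (m + k) m" if m: "m \<in> {2 * int L..3 * int L}" for m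
      proof -
        have "w (m + k) * w m = 1 / (2 * real L + 1)" using m S(3)[OF k] by (simp add: w_def)
        moreover have "w (m + k) * w m * (A * of_int (m + k - m) powr (- s1) * real L powr (2 * \<sigma> - (\<alpha> - 1) * s1)) \<le> pairing_term \<alpha> \<sigma> (- s1) w (m + k) m"
          unfolding A_def
          by (rule pairing_term_ge[OF \<alpha> \<sigma> _ w0]) (use m S(3)[OF k] L(1) s(1) in auto)
        ultimately show ?thesis using L(1) unfolding s(2) by simp
      qed
      have "A / 2 * of_int k powr (- s1) \<le> (real L + 1) / (2 * real L + 1) * (A * of_int k powr (- s1))"
      proof -
        have "1 / 2 \<le> (real L + 1) / (2 * real L + 1)" by (simp add: field_simps)
        from mult_right_mono[OF this, of "A * of_int k powr (- s1)"] show ?thesis using A by simp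
      qed
      also have "\<dots> = (\<Sum>m\<in>{2 * int L..3 * int L}. 1 / (2 * real L + 1) * (A * of_int k powr (- s1)))"
        by simp
      also have "\<dots> \<le> (\<Sum>m\<in>{2 * int L..3 * int L}. pairing_term \<alpha> \<sigma> (- s1) w (m + k) m)"
        by (rule sum_mono[OF t])
      finally show ?thesis .
    qed
    have "A / (2 * sqrt D) * sqrt H = \<beta> * (A / 2) * H"
      using D H by (simp add: \<beta>_def real_sqrt_mult real_div_sqrt field_simps)
    also have "\<dots> = (\<Sum>k\<in>S. \<beta> * (A / 2) * (1 / of_int k))" unfolding sum_distrib_left[symmetric] sumH ..
    also have "\<dots> = (\<Sum>k\<in>S. b k * (A / 2 * of_int k powr (- s1)))"
    proof (intro sum.cong refl)
      fix k assume "k \<in> S"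
      then have "real_of_int k powr (s1 - 1 + - s1) = 1 / of_int k"
        using S(3)[of k] by (simp add: powr_neg_one)
      then have e: "1 / of_int k = real_of_int k powr (s1 - 1) * of_int k powr (- s1)"
        by (simp only: powr_add)
      show "\<beta> * (A / 2) * (1 / of_int k) = b k * (A / 2 * of_int k powr (- s1))"
        unfolding b_def e by (simp only: mult_ac)
    qed
    also have "\<dots> \<le> (\<Sum>k\<in>S. b k * (\<Sum>m\<in>{2 * int L..3 * int L}. pairing_term \<alpha> \<sigma> (- s1) w (m + k) m))"
      by (intro sum_mono mult_left_mono inner b0)
    also have "\<dots> \<le> pairing \<alpha> \<sigma> (- s1) 0 {-int (4 * L)..int (4 * L)} S b w"
      by (rule pairing_ge) (use S b0 w0 in \<open>force+\<close>)
    finally show ?thesis using L(2) unfolding H_def by linarith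
  qed
  then have "large_block \<alpha> \<sigma> s1 s2 C (4 * L) S b w"
    unfolding large_block_def using S b0 w0 w2 b2 by (auto simp: w_def)
  then show ?thesis by blast
qed

section \<open>Divergence\<close>

theorem mainTheorem2:
  fixes \<alpha> \<sigma> s1 s2 :: real
  assumes "\<alpha> > 1" and "\<sigma> > 0"
    and "s1 < 2 * \<sigma> / (\<alpha> - 1) \<or>
         s2 < 2 * \<sigma> \<or>
         (s1 = 2 * \<sigma> / (\<alpha> - 1) \<and> s2 \<le> 1 / 2 - 2 * \<sigma> / (\<alpha> - 1))"
  shows "\<exists>u\<^sub>0\<in>L2_torus.
    \<not> W_convergent (- s1) (- s2) (\<lambda>N. dist_of_fun (renormalized_square \<alpha> \<sigma> u\<^sub>0 N))"
proof -
  have "\<exists>N S b w. large_block \<alpha> \<sigma> s1 s2 C N S b w" for C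
    using assms large_block_neighbouring_modes large_block_opposite_modes large_block_critical_exponents by metis
  then have "\<exists>N S b w. large_block \<alpha> \<sigma> s1 s2 (4 ^ j * real j) N S b w" for j by blast
  then obtain N S b w where blk: "\<And>j. large_block \<alpha> \<sigma> s1 s2 (4 ^ j * real j) (N j) (S j) (b j) (w j)"
    by metis
  let ?I = "\<lambda>j. {-int (N j)..int (N j)}"
  have S: "finite (S j)" "0 \<notin> S j" and b0: "0 \<le> b j k" and w0: "0 \<le> w j n" and supp: "n \<notin> ?I j \<Longrightarrow> w j n = 0"
    and w2: "(\<Sum>n\<in>?I j. (w j n)\<^sup>2) \<le> 1" and b2: "(\<Sum>k\<in>S j. (b j k)\<^sup>2 * japanese (of_int k) powr (2 * s2)) \<le> 1"
    and P: "4 ^ j * real j \<le> pairing \<alpha> \<sigma> (- s1) 0 (?I j) (S j) (b j) (w j)" for j k n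
    using blk[of j] unfolding large_block_def by auto
  obtain u where u: "u \<in> L2_torus" and summ: "\<And>n. summable (\<lambda>j. (1/2)^j * w j n)"
    and fc: "\<And>n. fourier_coeff u n = of_real (\<Sum>j. (1/2)^j * w j n)"
    using L2_torus_from_blocks[of ?I w, OF _ supp w2] by auto
  \<comment> \<open>Each block bounds the coefficients of \<open>u\<close> from below, because the other blocks are nonnegative.\<close>
  define c where "c n = (\<Sum>j. (1/2)^j * w j n)" for n
  have cw: "(1/2)^j * w j n \<le> c n" for j n
    using sum_le_suminf[OF summ[of n], of "{j}"] w0 by (simp add: c_def)
  have "\<not> W_convergent (- s1) (- s2) (\<lambda>N. dist_of_fun (renormalized_square \<alpha> \<sigma> u N))"
  proof
    assume "W_convergent (- s1) (- s2) (\<lambda>N. dist_of_fun (renormalized_square \<alpha> \<sigma> u N))"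
    from W_convergent_pairing_bounded[OF fc[folded c_def] this]
    obtain B N0 where B: "B \<ge> 0" and bd: "\<forall>N\<ge>N0. \<forall>S b. finite S \<longrightarrow> 0 \<notin> S \<longrightarrow>
      pairing \<alpha> \<sigma> (- s1) 0 {-int N..int N} S b c \<le> B * sqrt (\<Sum>k\<in>S. (b k)\<^sup>2 * japanese (of_int k) powr (2 * s2))"
      by auto
    have "real j \<le> B" for j
    proof -
      have "real j = ((1/2)^j)\<^sup>2 * (4 ^ j * real j)"
        by (simp add: power_mult[symmetric] mult.commute[of j] power_mult power_divide)
      also have "\<dots> \<le> ((1/2)^j)\<^sup>2 * pairing \<alpha> \<sigma> (- s1) 0 (?I j) (S j) (b j) (w j)"
        by (intro mult_left_mono P) simp
      also have "\<dots> = pairing \<alpha> \<sigma> (- s1) 0 (?I j) (S j) (b j) (\<lambda>n. (1/2)^j * w j n)"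
        by (rule pairing_scale[symmetric]) (use S in auto)
      also have "\<dots> \<le> pairing \<alpha> \<sigma> (- s1) 0 {-int (max N0 (N j))..int (max N0 (N j))} (S j) (b j) c"
        by (rule pairing_mono) (use S b0 w0 cw in auto)
      also have "\<dots> \<le> B * sqrt (\<Sum>k\<in>S j. (b j k)\<^sup>2 * japanese (of_int k) powr (2 * s2))"
        using bd S by auto
      also have "\<dots> \<le> B * 1" using b2[of j] by (intro mult_left_mono B) (simp add: real_sqrt_le_1_iff)
      finally show ?thesis by simp
    qed
    moreover obtain j :: nat where "B < real j" using reals_Archimedean2 by blast
    ultimately show False using not_le by blast
  qed
  then show ?thesis using u by blast
qed

end
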